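(* Let $\alpha\in(0,1)$ and $\gamma_1,\gamma_2>0$, and let $Z_{nk}$, $X_{nk}$ and $S_n=\sum_{k=1}^n Z_{nk}$ be as in the context, with $M_n=n^{\gamma_1}$ and $\varepsilon_n=n^{-\gamma_2}$. (i) If $\gamma_2>(1-\alpha)\gamma_1$ or $\gamma_2<\min\{(1-\alpha)\gamma_1,\,1-\alpha\gamma_1\}$, then $$\frac{S_n}{n\,\mathbb{E}[Z_{n1}]}\xrightarrow{p}1,\qquad n\to\infty.$$ (ii) If $\gamma_2>1-\alpha$ and $\gamma_2\in\left(1-\alpha,\ (1-\alpha)\gamma_1\right)$, then $$\frac{S_n}{n\,\mathbb{E}[X_{n1}]}\xrightarrow{p}1,\qquad n\to\infty.$$
   Context: Let $F_1$ be the distribution function of a probability distribution on $\mathbb{R}_+$ with $F_1(x)=1-e^{-\lambda x}(1+o(1))$ as $x\to+\infty$, for some $\lambda>0$. Let $F_2$ be the distribution function of a probability distribution with support on $[1,\infty)$ such that $F_2(x)=1-x^{-\alpha}(1+o(1))$ as $x\to+\infty$. For $M$ with $F_2(M)>0$, let $F_2^M$ be the distribution function of $F_2$ truncated at level $M$: $F_2^M(x)=F_2(x)/F_2(M)$ for $x\le M$ and $F_2^M(x)=1$ for $x>M$. Set $M_n=n^{\gamma_1}$ and $\varepsilon_n=n^{-\gamma_2}$ (only asymptotics as $n\to\infty$ matter, so $n$ may be taken large enough that $F_2(M_n)>0$ and $\varepsilon_n\in(0,1)$). For each $n$, let $Z_{nk}=(1-B_{nk})X_{nk}+B_{nk}Y_{nk}$,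 $k=1,\dots,n$, where $X_{nk}\sim F_1$, $Y_{nk}\sim F_2^{M_n}$, $B_{nk}$ is Bernoulli with success probability $\varepsilon_n$, and all $X_{nk},Y_{nk},B_{nk}$, $k=1,\dots,n$, are jointly independent. Thus $Z_{n1},\dots,Z_{nn}$ are i.i.d. with distribution function $(1-\varepsilon_n)F_1+\varepsilon_nF_2^{M_n}$. Put $S_n=\sum_{k=1}^n Z_{nk}$. The symbol $\xrightarrow{p}$ denotes convergence in probability. *)

theory Defs
  imports "HOL-Probability.Probability" "HOL-Library.Landau_Symbols"
begin

definition dist_fun_on :: "real set \<Rightarrow> (real \<Rightarrow> real) \<Rightarrow> bool" where
  "dist_fun_on A F \<longleftrightarrow> (\<exists>D. real_distribution D \<and> measure D A = 1 \<and> cdf D = F)"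

(* Only meaningful when F M > 0. *)
definition truncated_df :: "(real \<Rightarrow> real) \<Rightarrow> real \<Rightarrow> real \<Rightarrow> real" where
  "truncated_df F M x = (if x \<le> M then F x / F M else 1)"

(* A single row, with 3n jointly independent variables.  The three families are combined into one
   family over the disjoint sum of three copies of {1..n}, so that indep_vars expresses
   joint (not merely pairwise or family-by-family) independence.  The Bernoulli variables are
   real-valued, their law being the image of bernoulli_pmf under False -> 0, True -> 1. *)
definition mixture_row ::
  "(real \<Rightarrow> real) \<Rightarrow> (real \<Rightarrow> real) \<Rightarrow> real \<Rightarrow> real \<Rightarrow> nat \<Rightarrow> 'a measure \<Rightarrow>
   (nat \<Rightarrow> 'a \<Rightarrow> real) \<Rightarrow> (nat \<Rightarrow> 'a \<Rightarrow> real) \<Rightarrow> (nat \<Rightarrow> 'a \<Rightarrow> real) \<Rightarrow> bool" where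
  "mixture_row F\<^sub>1 F\<^sub>2 M \<epsilon> n P X Y B \<longleftrightarrow>
     prob_space P \<and>
     prob_space.indep_vars P (\<lambda>_. borel) (case_sum X (case_sum Y B))
       ({1..n} <+> ({1..n} <+> {1..n})) \<and>
     (\<forall>k\<in>{1..n}.
        cdf (distr P borel (X k)) = F\<^sub>1 \<and>
        cdf (distr P borel (Y k)) = truncated_df F\<^sub>2 M \<and>
        distr P borel (B k) = distr (measure_pmf (bernoulli_pmf \<epsilon>)) borel of_bool)"

(* Convergence in probability to a constant; the n-th variable may live on its own
   probability space P n, as is usual for triangular arrays. *)
definition conv_in_prob_const ::
  "(nat \<Rightarrow> 'a measure) \<Rightarrow> (nat \<Rightarrow> 'a \<Rightarrow> real) \<Rightarrow> real \<Rightarrow> bool" where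
  "conv_in_prob_const P W c \<longleftrightarrow>
     (\<forall>\<^sub>F n in sequentially. W n \<in> borel_measurable (P n)) \<and>
     (\<forall>\<delta>>0. (\<lambda>n. measure (P n) {\<omega> \<in> space (P n). \<bar>W n \<omega> - c\<bar> > \<delta>}) \<longlonglongrightarrow> 0)"

end

theory Submission
  imports Defs
begin

text \<open>
  Write \<open>m\<close> for the mean of the light-tailed law and \<open>y\<close> for the mean of the heavy-tailed law truncated
  at \<open>M = n powr \<gamma>\<^sub>1\<close>. The power tail with exponent \<open>\<alpha> < 1\<close> makes \<open>y\<close> of the exact order
  \<open>M powr (1 - \<alpha>)\<close> (\<open>\<nu>_upper\<close>, \<open>\<nu>_lower\<close>), so a summand has mean \<open>(1 - \<epsilon>) m + \<epsilon> y\<close>, where \<open>\<epsilon> y\<close> is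
  of the order of \<open>n powr ((1 - \<alpha>) \<gamma>\<^sub>1 - \<gamma>\<^sub>2)\<close>. Three mechanisms give the three regimes.

  If \<open>\<gamma>\<^sub>2 > (1 - \<alpha>) \<gamma>\<^sub>1\<close>, the contamination adds \<open>o(n)\<close> to the sum even in mean, so the sum
  behaves like the sum of the \<open>X\<close>, and its mean per summand tends to \<open>m\<close>.

  If \<open>\<gamma>\<^sub>2 < (1 - \<alpha>) \<gamma>\<^sub>1\<close>, the contamination dominates the mean. Chebyshev's inequality
  (\<open>relative_weak_law\<close>) still applies if the second moment, of order at most \<open>1 + \<epsilon> M y\<close>
  (\<open>Z_second_moment\<close>), is small against \<open>n (\<epsilon> y)\<^sup>2\<close>. As \<open>M / (n \<epsilon> y)\<close> is of the order of
  \<open>n powr (\<alpha> \<gamma>\<^sub>1 + \<gamma>\<^sub>2 - 1)\<close>, this holds precisely when \<open>\<gamma>\<^sub>2 < 1 - \<alpha> \<gamma>\<^sub>1\<close>: the sum then contains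
  many contaminated values close to the truncation level.

  If \<open>\<gamma>\<^sub>2 > 1 - \<alpha>\<close>, the contamination is negligible in probability, although its mean need not be:
  it is unlikely that any contaminating value above \<open>n\<close> is used, and the values up to \<open>n\<close> contribute
  \<open>o(n)\<close> in mean. The estimate \<open>contamination_prob_le\<close>, with a free cut-off, covers both this case and
  the first one.
\<close>

section \<open>Sums of independent variables\<close>

lemma (in prob_space) indep_vars_expectation_mult:
  fixes f g :: "real \<Rightarrow> real"
  assumes "indep_vars (\<lambda>_. borel) W I" "i \<in> I" "j \<in> I" "i \<noteq> j"
    and [measurable]: "f \<in> borel_measurable borel" "g \<in> borel_measurable borel"
    and "integrable M (\<lambda>\<omega>. f (W i \<omega>))" "integrable M (\<lambda>\<omega>. g (W j \<omega>))"
  shows "integrable M (\<lambda>\<omega>. f (W i \<omega>) * g (W j \<omega>))"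
    and "expectation (\<lambda>\<omega>. f (W i \<omega>) * g (W j \<omega>))
      = expectation (\<lambda>\<omega>. f (W i \<omega>)) * expectation (\<lambda>\<omega>. g (W j \<omega>))"
proof -
  have "indep_vars (\<lambda>_. borel) W {i, j}"
    using assms(1-3) by (blast intro: indep_vars_subset)
  then have ind: "indep_vars (\<lambda>_. borel) (\<lambda>k \<omega>. (if k = i then f else g) (W k \<omega>)) {i, j}"
    by (rule indep_vars_compose2) auto
  have int: "integrable M (\<lambda>\<omega>. (if k = i then f else g) (W k \<omega>))" if "k \<in> {i, j}" for k
    using that assms by auto
  show "integrable M (\<lambda>\<omega>. f (W i \<omega>) * g (W j \<omega>))"
    using indep_vars_integrable[OF _ ind int] \<open>i \<noteq> j\<close> by simp
  show "expectation (\<lambda>\<omega>. f (W i \<omega>) * g (W j \<omega>))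
      = expectation (\<lambda>\<omega>. f (W i \<omega>)) * expectation (\<lambda>\<omega>. g (W j \<omega>))"
    using indep_vars_lebesgue_integral[OF _ ind int] \<open>i \<noteq> j\<close> by simp
qed

text \<open>
  Expanding the square of the centred sum, independence kills every off-diagonal covariance.
\<close>

lemma (in prob_space) variance_sum_indep:
  fixes W :: "'i \<Rightarrow> 'a \<Rightarrow> real"
  assumes fin: "finite I" and ind: "indep_vars (\<lambda>_. borel) W I"
    and sq: "\<And>i. i \<in> I \<Longrightarrow> integrable M (\<lambda>\<omega>. (W i \<omega>)\<^sup>2)"
  shows "integrable M (\<lambda>\<omega>. (\<Sum>i\<in>I. W i \<omega>)\<^sup>2)"
    and "variance (\<lambda>\<omega>. \<Sum>i\<in>I. W i \<omega>) = (\<Sum>i\<in>I. variance (W i))"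
proof -
  define m where "m i = expectation (W i)" for i
  have rv [measurable]: "random_variable borel (W i)" if "i \<in> I" for i
    using ind that by (auto simp: indep_vars_def)
  have int: "integrable M (W i)" if "i \<in> I" for i
    using rv[OF that] sq[OF that] by (rule square_integrable_imp_integrable)
  have prod: "integrable M (\<lambda>\<omega>. (W i \<omega> - c) * (W j \<omega> - d))" if "i \<in> I" "j \<in> I" for i j c d
  proof (cases "i = j")
    case True
    then show ?thesis
      using int[OF that(1)] sq[OF that(1)]
      by (auto simp: algebra_simps power2_eq_square)
  next
    case False
    with that ind int show ?thesis
      by (intro indep_vars_expectation_mult(1)[where f="\<lambda>x. x - c" and g="\<lambda>x. x - d"]) auto
  qed
  have "(\<lambda>\<omega>. (\<Sum>i\<in>I. W i \<omega>)\<^sup>2) = (\<lambda>\<omega>. \<Sum>i\<in>I. \<Sum>j\<in>I. W i \<omega> * W j \<omega>)"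
    by (simp add: power2_eq_square sum_product)
  then show "integrable M (\<lambda>\<omega>. (\<Sum>i\<in>I. W i \<omega>)\<^sup>2)"
    using prod[of _ _ 0 0] by (auto intro!: Bochner_Integration.integrable_sum)
  have cov: "expectation (\<lambda>\<omega>. (W i \<omega> - m i) * (W j \<omega> - m j)) = (if i = j then variance (W i) else 0)"
    if "i \<in> I" "j \<in> I" for i j
  proof (cases "i = j")
    case False
    have "expectation (\<lambda>\<omega>. (W i \<omega> - m i) * (W j \<omega> - m j))
        = expectation (\<lambda>\<omega>. W i \<omega> - m i) * expectation (\<lambda>\<omega>. W j \<omega> - m j)"
      using False that ind int
      by (intro indep_vars_expectation_mult(2)[where f="\<lambda>x. x - m i" and g="\<lambda>x. x - m j"]) auto
    then show ?thesis
      using False int that by (simp add: m_def prob_space)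
  qed (simp add: m_def power2_eq_square)
  have "variance (\<lambda>\<omega>. \<Sum>i\<in>I. W i \<omega>) = expectation (\<lambda>\<omega>. \<Sum>i\<in>I. \<Sum>j\<in>I. (W i \<omega> - m i) * (W j \<omega> - m j))"
    using int by (simp add: m_def sum_subtractf power2_eq_square flip: sum_product)
  also have "\<dots> = (\<Sum>i\<in>I. \<Sum>j\<in>I. expectation (\<lambda>\<omega>. (W i \<omega> - m i) * (W j \<omega> - m j)))"
    using prod by (subst Bochner_Integration.integral_sum, auto)+
  also have "\<dots> = (\<Sum>i\<in>I. variance (W i))"
    using fin by (simp add: cov cong: sum.cong)
  finally show "variance (\<lambda>\<omega>. \<Sum>i\<in>I. W i \<omega>) = (\<Sum>i\<in>I. variance (W i))" .
qed

text \<open>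
  Chebyshev's inequality, measured relative to the mean. For i.i.d. summands with mean \<open>m\<close> and
  second moment \<open>v\<close> the sum concentrates as soon as \<open>v\<close> is small compared with
  \<open>n m\<^sup>2\<close>; the moments may depend on \<open>n\<close>, which is what a triangular array requires.
\<close>

lemma (in prob_space) relative_chebyshev_sum:
  fixes W :: "'i \<Rightarrow> 'a \<Rightarrow> real" and m v \<delta> :: real
  assumes fin: "finite I" "I \<noteq> {}" and ind: "indep_vars (\<lambda>_. borel) W I"
    and sq: "\<And>i. i \<in> I \<Longrightarrow> integrable M (\<lambda>\<omega>. (W i \<omega>)\<^sup>2)"
    and mean: "\<And>i. i \<in> I \<Longrightarrow> expectation (W i) = m"
    and second: "\<And>i. i \<in> I \<Longrightarrow> expectation (\<lambda>\<omega>. (W i \<omega>)\<^sup>2) \<le> v"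
    and pos: "0 < m" "0 < \<delta>"
  shows "prob {\<omega> \<in> space M. \<bar>(\<Sum>i\<in>I. W i \<omega>) / (card I * m) - 1\<bar> > \<delta>} \<le> v / (card I * m\<^sup>2) / \<delta>\<^sup>2"
proof -
  define N where "N = real (card I)"
  have N: "0 < N" using fin by (simp add: N_def card_gt_0_iff)
  have rv [measurable]: "random_variable borel (W i)" if "i \<in> I" for i
    using ind that by (auto simp: indep_vars_def)
  have int: "integrable M (W i)" if "i \<in> I" for i
    using rv[OF that] sq[OF that] by (rule square_integrable_imp_integrable)
  have mS: "expectation (\<lambda>\<omega>. \<Sum>i\<in>I. W i \<omega>) = N * m"
    using int mean by (simp add: N_def)
  have "variance (W i) \<le> v" if "i \<in> I" for i
    using variance_eq[OF int[OF that] sq[OF that]] second[OF that] zero_le_power2[of "expectation (W i)"]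
    by linarith
  then have var: "variance (\<lambda>\<omega>. \<Sum>i\<in>I. W i \<omega>) \<le> N * v"
    using sum_mono[of I "\<lambda>i. variance (W i)" "\<lambda>_. v"] by (simp add: variance_sum_indep[OF fin(1) ind sq] N_def)
  have dev: "\<bar>s - N * m\<bar> \<ge> \<delta> * (N * m)" if "\<bar>s / (N * m) - 1\<bar> > \<delta>" for s
  proof -
    have "s - N * m = (s / (N * m) - 1) * (N * m)"
      using N pos by (simp add: field_simps)
    then have "\<bar>s - N * m\<bar> = \<bar>s / (N * m) - 1\<bar> * (N * m)"
      using N pos by (simp add: abs_mult)
    with that N pos show ?thesis by simp
  qed
  have "prob {\<omega> \<in> space M. \<bar>(\<Sum>i\<in>I. W i \<omega>) / (N * m) - 1\<bar> > \<delta>}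
      \<le> prob {\<omega> \<in> space M. \<bar>(\<Sum>i\<in>I. W i \<omega>) - expectation (\<lambda>\<omega>. \<Sum>i\<in>I. W i \<omega>)\<bar> \<ge> \<delta> * (N * m)}"
    unfolding mS using dev by (intro finite_measure_mono) auto
  also have "\<dots> \<le> variance (\<lambda>\<omega>. \<Sum>i\<in>I. W i \<omega>) / (\<delta> * (N * m))\<^sup>2"
    using N pos variance_sum_indep(1)[OF fin(1) ind sq] by (intro Chebyshev_inequality) auto
  also have "\<dots> \<le> N * v / (\<delta> * (N * m))\<^sup>2"
    using var by (intro divide_right_mono) auto
  also have "\<dots> = v / (N * m\<^sup>2) / \<delta>\<^sup>2"
    using N pos by (simp add: field_simps power2_eq_square)
  finally show ?thesis by (simp add: N_def)
qed

section \<open>Moments from tails\<close>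

text \<open>
  A nonnegative number \<open>y\<close> is the length of \<open>{0<..<y}\<close>; integrating this over the space and exchanging
  the two integrals expresses the mean through the tail. Where \<open>f\<close> is negative both sides see \<open>0\<close>.
\<close>

lemma nn_integral_layer_cake:
  fixes f :: "'a \<Rightarrow> real"
  assumes "sigma_finite_measure N" and [measurable]: "f \<in> borel_measurable N"
  shows "(\<integral>\<^sup>+x. ennreal (f x) \<partial>N)
    = (\<integral>\<^sup>+t. indicator {0<..} t * emeasure N {x \<in> space N. t < f x} \<partial>lborel)"
proof -
  interpret N: sigma_finite_measure N by fact
  interpret pair_sigma_finite N lborel ..
  have "(\<integral>\<^sup>+x. ennreal (f x) \<partial>N) = (\<integral>\<^sup>+x. emeasure lborel {0<..<f x} \<partial>N)"
  proof (intro nn_integral_cong)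
    show "ennreal (f x) = emeasure lborel {0<..<f x}" for x
      by (cases "0 \<le> f x") (auto simp: ennreal_neg)
  qed
  also have "\<dots> = (\<integral>\<^sup>+x. (\<integral>\<^sup>+t. indicator {0<..} t * indicator {..<f x} t \<partial>lborel) \<partial>N)"
    by (intro nn_integral_cong) (auto simp flip: nn_integral_indicator intro!: nn_integral_cong split: split_indicator)
  also have "\<dots> = (\<integral>\<^sup>+t. (\<integral>\<^sup>+x. indicator {0<..} t * indicator {..<f x} t \<partial>N) \<partial>lborel)"
    by (intro Fubini'[symmetric]) (simp add: indicator_def)
  also have "\<dots> = (\<integral>\<^sup>+t. indicator {0<..} t * emeasure N {x \<in> space N. t < f x} \<partial>lborel)"
    by (intro nn_integral_cong, subst nn_integral_cmult)
       (auto simp flip: nn_integral_indicator intro!: nn_integral_cong split: split_indicator simp: indicator_def)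
  finally show ?thesis .
qed

text \<open>
  Truncation at \<open>T\<close> cuts the layer-cake integral off at \<open>T\<close>, so a tail \<open>C t powr (- \<alpha>)\<close> with
  \<open>\<alpha> < 1\<close>, too heavy for a finite mean, contributes only \<open>C * T powr (1 - \<alpha>) / (1 - \<alpha>)\<close>.
\<close>

lemma (in prob_space) expectation_min_le_of_power_tail:
  fixes Y :: "'a \<Rightarrow> real"
  assumes [measurable]: "random_variable borel Y"
    and nonneg: "AE \<omega> in M. 0 \<le> Y \<omega>"
    and tail: "\<And>t. 0 < t \<Longrightarrow> prob {\<omega> \<in> space M. t < Y \<omega>} \<le> C * t powr (- \<alpha>)"
    and \<alpha>: "\<alpha> < 1" and T: "0 \<le> T" and C: "0 \<le> C"
  shows "expectation (\<lambda>\<omega>. min (Y \<omega>) T) \<le> C / (1 - \<alpha>) * T powr (1 - \<alpha>)"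
proof -
  have "(\<integral>\<^sup>+\<omega>. ennreal (min (Y \<omega>) T) \<partial>M)
      = (\<integral>\<^sup>+t. indicator {0<..} t * emeasure M {\<omega> \<in> space M. t < min (Y \<omega>) T} \<partial>lborel)"
    by (intro nn_integral_layer_cake) (auto intro: sigma_finite_measure_axioms)
  also have "\<dots> \<le> (\<integral>\<^sup>+t. ennreal (C * t powr (- \<alpha>)) * indicator {0..T} t \<partial>lborel)"
  proof (intro nn_integral_mono)
    fix t :: real
    show "indicator {0<..} t * emeasure M {\<omega> \<in> space M. t < min (Y \<omega>) T}
        \<le> ennreal (C * t powr (- \<alpha>)) * indicator {0..T} t"
      using tail[of t] C by (cases "0 < t"; cases "t < T") (auto simp: emeasure_eq_measure)
  qed
  also have "\<dots> = ennreal (C * (T powr (1 - \<alpha>) / (1 - \<alpha>)))"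
  proof (rule nn_integral_has_integral_lebesgue')
    show "((\<lambda>t. C * t powr (- \<alpha>)) has_integral C * (T powr (1 - \<alpha>) / (1 - \<alpha>))) {0..T}"
      using has_integral_mult_right[OF has_integral_powr_from_0[of "- \<alpha>" T], of C] \<alpha> T by simp
  qed (use C in auto)
  finally have "(\<integral>\<^sup>+\<omega>. ennreal (min (Y \<omega>) T) \<partial>M) \<le> ennreal (C * (T powr (1 - \<alpha>) / (1 - \<alpha>)))" .
  then show ?thesis
    using nonneg T C \<alpha>
    by (intro integral_real_bounded[THEN order_trans]) auto
qed

section \<open>Consequences of the tail asymptotics\<close>

lemma power_tail_two_sided:
  fixes F :: "real \<Rightarrow> real"
  assumes "(\<lambda>x. 1 - F x) \<sim>[at_top] (\<lambda>x. x powr (- \<alpha>))"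
  shows "\<forall>\<^sub>F x in at_top. x powr (- \<alpha>) / 2 \<le> 1 - F x \<and> 1 - F x \<le> 2 * x powr (- \<alpha>)"
proof -
  have "((\<lambda>x. (1 - F x) / x powr (- \<alpha>)) \<longlongrightarrow> 1) at_top"
    by (rule asymp_equivD_strong[OF assms], rule eventually_mono[OF eventually_gt_at_top[of 0]]) simp
  then have "\<forall>\<^sub>F x in at_top. (1 - F x) / x powr (- \<alpha>) \<in> {1/2<..<2}"
    by (rule topological_tendstoD) auto
  with eventually_gt_at_top[of 0] show ?thesis
  proof eventually_elim
    case (elim x)
    then show ?case
      by (auto simp: field_simps)
  qed
qed

text \<open>
  Far out the asymptotics give the factor \<open>2\<close>; below some \<open>y\<close> the trivial bound \<open>1 - F x \<le> 1\<close>
  is at most \<open>(y / x) powr \<alpha>\<close>.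
\<close>

lemma power_tail_upper:
  fixes F :: "real \<Rightarrow> real"
  assumes "(\<lambda>x. 1 - F x) \<sim>[at_top] (\<lambda>x. x powr (- \<alpha>))" and "0 < \<alpha>" and "\<And>x. 0 \<le> F x"
  obtains C where "0 < C" "\<And>x. 0 < x \<Longrightarrow> 1 - F x \<le> C * x powr (- \<alpha>)"
proof -
  obtain x0 where x0: "\<And>x. x \<ge> x0 \<Longrightarrow> 1 - F x \<le> 2 * x powr (- \<alpha>)"
    using power_tail_two_sided[OF assms(1)] by (auto simp: eventually_at_top_linorder)
  define y where "y = max x0 1"
  define C where "C = max 2 (y powr \<alpha>)"
  have "1 - F x \<le> C * x powr (- \<alpha>)" if "0 < x" for x
  proof (cases "x \<ge> y")
    case True
    then have "1 - F x \<le> 2 * x powr (- \<alpha>)" using x0 by (simp add: y_def)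
    also have "\<dots> \<le> C * x powr (- \<alpha>)" by (intro mult_right_mono) (auto simp: C_def)
    finally show ?thesis .
  next
    case False
    then have "x powr \<alpha> \<le> C"
      using \<open>0 < \<alpha>\<close> that powr_mono2[of \<alpha> x y] by (simp add: C_def)
    then have "1 \<le> C * x powr (- \<alpha>)"
      using that by (simp add: powr_minus field_simps)
    then show ?thesis using assms(3)[of x] by linarith
  qed
  moreover have "0 < C" by (simp add: C_def)
  ultimately show ?thesis using that by blast
qed

text \<open>
  The piece of mass that truncation cannot remove. Since the tail at \<open>\<theta> * x\<close> is about
  \<open>\<theta> powr (- \<alpha>)\<close> times the tail at \<open>x\<close>, for small \<open>\<theta>\<close> the interval from \<open>\<theta> * x\<close> to \<open>x\<close>
  carries mass of the order of \<open>x powr (- \<alpha>)\<close>.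
\<close>

lemma power_tail_increment:
  fixes F :: "real \<Rightarrow> real"
  assumes "(\<lambda>x. 1 - F x) \<sim>[at_top] (\<lambda>x. x powr (- \<alpha>))" and "0 < \<alpha>"
  obtains \<theta> where "0 < \<theta>" "\<theta> < 1" "\<forall>\<^sub>F x in at_top. x powr (- \<alpha>) \<le> F x - F (\<theta> * x)"
proof
  \<comment> \<open>With \<open>\<theta> powr (- \<alpha>) = 6\<close> the two-sided bounds give \<open>6 / 2 - 2 = 1\<close> times \<open>x powr (- \<alpha>)\<close>.\<close>
  define \<theta> :: real where "\<theta> = 6 powr (- (1 / \<alpha>))"
  have pow: "\<theta> powr (- \<alpha>) = 6"
    using \<open>0 < \<alpha>\<close> by (simp add: \<theta>_def powr_powr)
  show "0 < \<theta>" by (simp add: \<theta>_def)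
  show "\<theta> < 1" using \<open>0 < \<alpha>\<close> unfolding \<theta>_def by (intro powr_less_one) auto
  have lim: "filterlim (\<lambda>x. \<theta> * x) at_top at_top"
    using \<open>0 < \<theta>\<close> by (intro filterlim_tendsto_pos_mult_at_top[OF tendsto_const _ filterlim_ident])
  have ev: "\<forall>\<^sub>F x in at_top. x powr (- \<alpha>) / 2 \<le> 1 - F x \<and> 1 - F x \<le> 2 * x powr (- \<alpha>)"
    by (rule power_tail_two_sided[OF assms(1)])
  have "\<forall>\<^sub>F x in at_top. (\<theta> * x) powr (- \<alpha>) / 2 \<le> 1 - F (\<theta> * x)"
    using eventually_compose_filterlim[OF ev lim] by eventually_elim simp
  then show "\<forall>\<^sub>F x in at_top. x powr (- \<alpha>) \<le> F x - F (\<theta> * x)"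
    using ev eventually_gt_at_top[of 0]
  proof eventually_elim
    case (elim x)
    then have "(\<theta> * x) powr (- \<alpha>) = 6 * x powr (- \<alpha>)"
      using \<open>0 < \<theta>\<close> by (simp add: powr_mult pow)
    with elim show ?case by simp
  qed
qed

text \<open>
  The exponential tail is at most \<open>C / (1 + x\<^sup>2)\<^sup>2\<close> for some \<open>C\<close>: at \<open>x = sqrt t\<close> this bound
  becomes \<open>C / (1 + t)\<^sup>2\<close>, whose integral is elementary, so the layer-cake formula for \<open>x\<^sup>2\<close>
  converges. The mean is positive because the tail, being asymptotic to a positive function, is
  itself positive somewhere far to the right.
\<close>

lemma exponential_tail_moments:
  fixes D :: "real measure"
  assumes "real_distribution D" and nonneg: "measure D {0..} = 1"
    and tail: "(\<lambda>x. 1 - cdf D x) \<sim>[at_top] (\<lambda>x. exp (- lam * x))" and lam: "0 < lam"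
  shows "integrable D (\<lambda>x. x\<^sup>2)" and "0 < (\<integral>x. x \<partial>D)"
proof -
  interpret D: real_distribution D by fact
  have AE0: "AE x in D. 0 \<le> x"
    using D.AE_prob_1[OF nonneg] by simp
  have gt: "measure D {x<..} = 1 - cdf D x" for x
  proof -
    have "{x<..} = space D - {..x}" by (auto simp: D.borel_UNIV)
    then show ?thesis using D.prob_compl[of "{..x}"] by (simp add: cdf_def)
  qed
  have equiv: "((\<lambda>x. (1 - cdf D x) / exp (- lam * x)) \<longlongrightarrow> 1) at_top"
    by (rule asymp_equivD_strong[OF tail]) simp
  have "((\<lambda>x. (1 - cdf D x) / exp (- lam * x) * ((1 + x\<^sup>2)\<^sup>2 * exp (- lam * x))) \<longlongrightarrow> 1 * 0) at_top"
    using lam by (intro tendsto_mult equiv) real_asymp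
  then have "\<forall>\<^sub>F x in at_top. (1 - cdf D x) * (1 + x\<^sup>2)\<^sup>2 < 1"
    by (auto dest!: order_tendstoD(2)[of _ _ _ 1] simp: mult_ac)
  then obtain x0 where x0: "\<And>x. x \<ge> x0 \<Longrightarrow> (1 - cdf D x) * (1 + x\<^sup>2)\<^sup>2 < 1"
    by (auto simp: eventually_at_top_linorder)
  define C where "C = (1 + x0\<^sup>2)\<^sup>2"
  have C: "1 \<le> C" by (simp add: C_def)
  have bound: "1 - cdf D x \<le> C / (1 + x\<^sup>2)\<^sup>2" if "0 \<le> x" for x
  proof -
    have pos: "0 < 1 + x\<^sup>2" by (simp add: add_pos_nonneg)
    have "(1 - cdf D x) * (1 + x\<^sup>2)\<^sup>2 \<le> C"
    proof (cases "x \<ge> x0")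
      case True
      with x0[of x] C show ?thesis by linarith
    next
      case False
      then have "x\<^sup>2 \<le> x0\<^sup>2" using that by (intro power_mono) auto
      then have "(1 + x\<^sup>2)\<^sup>2 \<le> C" unfolding C_def by (intro power_mono) auto
      then have "(1 - cdf D x) * (1 + x\<^sup>2)\<^sup>2 \<le> 1 * C"
        using D.cdf_nonneg[of x] D.cdf_bounded_prob[of x] by (intro mult_mono) auto
      then show ?thesis by simp
    qed
    with pos show ?thesis by (simp add: field_simps)
  qed
  have "(\<integral>\<^sup>+x. ennreal (x\<^sup>2) \<partial>D)
      = (\<integral>\<^sup>+t. indicator {0<..} t * emeasure D {x \<in> space D. t < x\<^sup>2} \<partial>lborel)"
    by (intro nn_integral_layer_cake D.sigma_finite_measure_axioms) simp
  also have "\<dots> \<le> (\<integral>\<^sup>+t. ennreal (C / (1 + t)\<^sup>2) * indicator {0..} t \<partial>lborel)"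
  proof (intro nn_integral_mono)
    fix t :: real
    show "indicator {0<..} t * emeasure D {x \<in> space D. t < x\<^sup>2} \<le> ennreal (C / (1 + t)\<^sup>2) * indicator {0..} t"
    proof (cases "0 < t")
      case True
      have "measure D {x \<in> space D. t < x\<^sup>2} \<le> measure D {sqrt t<..}"
        using AE0 by (intro D.finite_measure_mono_AE) (auto intro!: real_less_lsqrt)
      also have "\<dots> \<le> C / (1 + t)\<^sup>2"
        using bound[of "sqrt t"] True by (simp add: gt)
      finally show ?thesis
        using True by (simp add: D.emeasure_eq_measure ennreal_leI)
    qed simp
  qed
  also have "\<dots> = ennreal (0 - (- C / (1 + 0)))"
  proof (rule nn_integral_FTC_atLeast)
    show "((\<lambda>t. - C / (1 + t)) \<longlongrightarrow> 0) at_top" by real_asymp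
    show "((\<lambda>t. - C / (1 + t)) has_real_derivative C / (1 + t)\<^sup>2) (at t)" if "0 \<le> t" for t
      using that by (auto intro!: derivative_eq_intros simp: power2_eq_square)
  qed (use C in auto)
  finally have fin: "(\<integral>\<^sup>+x. ennreal (x\<^sup>2) \<partial>D) < \<infinity>"
    by (rule le_less_trans) simp
  show sq: "integrable D (\<lambda>x. x\<^sup>2)"
    by (rule integrableI_bounded) (use fin in auto)
  then have int: "integrable D (\<lambda>x. x)"
    by (rule D.square_integrable_imp_integrable[rotated]) simp
  have "\<forall>\<^sub>F x in at_top. (1 - cdf D x) / exp (- lam * x) > 0"
    using equiv by (rule order_tendstoD) simp
  then have "\<forall>\<^sub>F x in at_top. 0 < x \<and> (1 - cdf D x) / exp (- lam * x) > 0"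
    using eventually_gt_at_top[of 0] by eventually_elim simp
  then obtain x where x: "0 < x" "0 < 1 - cdf D x"
    by (auto simp: eventually_at_top_linorder zero_less_divide_iff)
  have "0 < x * measure D {x<..}" using x by (simp add: gt)
  also have "\<dots> \<le> x * measure D {y \<in> space D. x \<le> y}"
    using x by (intro mult_left_mono D.finite_measure_mono) auto
  also have "\<dots> \<le> (\<integral>y. y \<partial>D)"
    using integral_Markov_inequality_measure[OF int _ AE0 x(1), of UNIV] x by (simp add: field_simps)
  finally show "0 < (\<integral>x. x \<partial>D)" .
qed

section \<open>A single row of the contaminated array\<close>

text \<open>
  One row of the array, at truncation level \<open>L\<close>, with the law \<open>D\<close> of the light-tailed variables
  given as a measure so that their moments are the same numbers in every row. All estimates in
  this section are exact inequalities for a fixed row.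
\<close>

locale contaminated_row = prob_space P for P :: "'a measure" +
  fixes F\<^sub>1 F\<^sub>2 :: "real \<Rightarrow> real" and L \<epsilon> :: real and n :: nat
    and X Y B :: "nat \<Rightarrow> 'a \<Rightarrow> real" and D :: "real measure"
  assumes row: "mixture_row F\<^sub>1 F\<^sub>2 L \<epsilon> n P X Y B"
    and D: "real_distribution D" "cdf D = F\<^sub>1"
    and D_nonneg: "AE x in D. 0 \<le> x"
    and D_sq: "integrable D (\<lambda>x. x\<^sup>2)"
    and F2: "dist_fun_on {1..} F\<^sub>2"
    and L: "0 < L" "0 < F\<^sub>2 L"
    and \<epsilon>: "0 \<le> \<epsilon>" "\<epsilon> \<le> 1"
    and n: "0 < n"
begin

(* Otherwise the simplifier turns the representative index 1 into Suc 0, and the facts about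
   Y 1 no longer match. *)
declare One_nat_def [simp del]

definition \<mu> :: real where "\<mu> = (\<integral>x. x \<partial>D)"
definition \<nu> :: real where "\<nu> = expectation (Y 1)"
definition Z :: "nat \<Rightarrow> 'a \<Rightarrow> real" where
  "Z k \<omega> = (1 - B k \<omega>) * X k \<omega> + B k \<omega> * Y k \<omega>"

abbreviation "V \<equiv> case_sum X (case_sum Y B)"
abbreviation "I \<equiv> {1..n} <+> ({1..n} <+> {1..n})"

lemma indep: "indep_vars (\<lambda>_. borel) V I"
  using row by (simp add: mixture_row_def)

lemma index_mem:
  assumes "k \<in> {1..n}"
  shows "Inl k \<in> I" "Inr (Inl k) \<in> I" "Inr (Inr k) \<in> I"
  using assms by auto

lemma random_variables:
  assumes "k \<in> {1..n}"
  shows X_measurable: "random_variable borel (X k)"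
    and Y_measurable: "random_variable borel (Y k)"
    and B_measurable: "random_variable borel (B k)"
proof -
  have "random_variable borel (V i)" if "i \<in> I" for i
    using indep that by (simp add: indep_vars_def)
  from this[OF index_mem(1)[OF assms]] this[OF index_mem(2)[OF assms]] this[OF index_mem(3)[OF assms]]
  show "random_variable borel (X k)" "random_variable borel (Y k)" "random_variable borel (B k)"
    by simp_all
qed

lemma Z_measurable: "k \<in> {1..n} \<Longrightarrow> random_variable borel (Z k)"
  unfolding Z_def using random_variables by measurable

lemma indep_X: "indep_vars (\<lambda>_. borel) X {1..n}"
proof -
  have "indep_vars (\<lambda>k. PiM {Inl k} (\<lambda>_. borel)) (\<lambda>k \<omega>. restrict (\<lambda>i. V i \<omega>) {Inl k}) {1..n}"
    by (rule indep_vars_restrict[OF indep]) (auto simp: disjoint_family_on_def)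
  then have "indep_vars (\<lambda>_. borel) (\<lambda>k \<omega>. restrict (\<lambda>i. V i \<omega>) {Inl k} (Inl k)) {1..n}"
    by (rule indep_vars_compose2[where Y="\<lambda>k x. x (Inl k)"]) (rule measurable_component_singleton, simp)
  then show ?thesis by simp
qed

text \<open>
  The variables \<open>Z k\<close> are functions of disjoint blocks of the jointly independent family.
\<close>

lemma indep_Z: "indep_vars (\<lambda>_. borel) Z {1..n}"
proof -
  define K :: "nat \<Rightarrow> (nat + (nat + nat)) set" where "K k = {Inl k, Inr (Inl k), Inr (Inr k)}" for k
  define g where "g k x = (1 - x (Inr (Inr k))) * x (Inl k) + x (Inr (Inr k)) * (x (Inr (Inl k)) :: real)"
    for k :: nat and x :: "nat + (nat + nat) \<Rightarrow> real"
  have "indep_vars (\<lambda>k. PiM (K k) (\<lambda>_. borel)) (\<lambda>k \<omega>. restrict (\<lambda>i. V i \<omega>) (K k)) {1..n}"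
    by (rule indep_vars_restrict[OF indep]) (auto simp: K_def disjoint_family_on_def)
  then have "indep_vars (\<lambda>_. borel) (\<lambda>k \<omega>. g k (restrict (\<lambda>i. V i \<omega>) (K k))) {1..n}"
  proof (rule indep_vars_compose2)
    show "g k \<in> borel_measurable (PiM (K k) (\<lambda>_. borel))" for k
      unfolding g_def K_def by measurable
  qed
  also have "(\<lambda>k \<omega>. g k (restrict (\<lambda>i. V i \<omega>) (K k))) = Z"
    by (simp add: g_def Z_def K_def fun_eq_iff)
  finally show ?thesis .
qed

lemma distr_X: "k \<in> {1..n} \<Longrightarrow> distr P borel (X k) = D"
  using row D X_measurable by (intro cdf_unique) (auto simp: mixture_row_def)

lemma X_moments:
  assumes k: "k \<in> {1..n}"
  shows "AE \<omega> in P. 0 \<le> X k \<omega>"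
    and "integrable P (\<lambda>\<omega>. (X k \<omega>)\<^sup>2)" and "integrable P (X k)"
    and "expectation (X k) = \<mu>" and "expectation (\<lambda>\<omega>. (X k \<omega>)\<^sup>2) = (\<integral>x. x\<^sup>2 \<partial>D)"
proof -
  note [measurable] = X_measurable[OF k]
  show "AE \<omega> in P. 0 \<le> X k \<omega>"
    using D_nonneg unfolding distr_X[OF k, symmetric] by (subst (asm) AE_distr_iff) auto
  show sq: "integrable P (\<lambda>\<omega>. (X k \<omega>)\<^sup>2)"
    using D_sq unfolding distr_X[OF k, symmetric] by (simp add: integrable_distr_eq)
  show "integrable P (X k)"
    using sq by (rule square_integrable_imp_integrable[rotated]) simp
  have "expectation (X k) = (\<integral>x. x \<partial>D)"
    unfolding distr_X[OF k, symmetric] by (simp add: integral_distr)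
  then show "expectation (X k) = \<mu>" by (simp add: \<mu>_def)
  show "expectation (\<lambda>\<omega>. (X k \<omega>)\<^sup>2) = (\<integral>x. x\<^sup>2 \<partial>D)"
    unfolding distr_X[OF k, symmetric] by (simp add: integral_distr)
qed

lemma B_moments:
  assumes k: "k \<in> {1..n}"
  shows "AE \<omega> in P. B k \<omega> \<in> {0, 1}" and "integrable P (B k)" and "expectation (B k) = \<epsilon>"
proof -
  note [measurable] = B_measurable[OF k]
  have law: "distr P borel (B k) = distr (measure_pmf (bernoulli_pmf \<epsilon>)) borel of_bool"
    using row k by (simp add: mixture_row_def)
  have "AE x in distr P borel (B k). x \<in> {0, 1}"
    unfolding law by (subst AE_distr_iff) auto
  then show AE: "AE \<omega> in P. B k \<omega> \<in> {0, 1}"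
    by (subst (asm) AE_distr_iff) auto
  show "integrable P (B k)"
    by (rule integrable_const_bound[of _ 1]) (use AE in auto)
  have "expectation (B k) = (\<integral>x. x \<partial>distr P borel (B k))"
    by (simp add: integral_distr)
  also have "\<dots> = measure_pmf.expectation (bernoulli_pmf \<epsilon>) of_bool"
    unfolding law by (simp add: integral_distr)
  finally show "expectation (B k) = \<epsilon>"
    using \<epsilon> by simp
qed

lemma F2_bounds: "0 \<le> F\<^sub>2 x" "F\<^sub>2 x \<le> 1" "x < 1 \<Longrightarrow> F\<^sub>2 x = 0"
proof -
  obtain E where E: "real_distribution E" "measure E {1..} = 1" "cdf E = F\<^sub>2"
    using F2 by (auto simp: dist_fun_on_def)
  interpret E: real_distribution E by fact
  show "0 \<le> F\<^sub>2 x" "F\<^sub>2 x \<le> 1"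
    using E.cdf_nonneg E.cdf_bounded_prob E(3) by auto
  assume "x < 1"
  then have "measure E {..x} \<le> measure E (space E - {1..})"
    by (intro E.finite_measure_mono) auto
  also have "\<dots> = 0" using E.prob_compl[of "{1..}"] E(2) by simp
  finally show "F\<^sub>2 x = 0" using E(3) measure_nonneg[of E "{..x}"] by (auto simp: cdf_def fun_eq_iff)
qed

lemma prob_Y_gt:
  assumes k: "k \<in> {1..n}"
  shows "prob {\<omega> \<in> space P. t < Y k \<omega>} = 1 - truncated_df F\<^sub>2 L t"
proof -
  note [measurable] = Y_measurable[OF k]
  have "truncated_df F\<^sub>2 L t = cdf (distr P borel (Y k)) t"
    using row k by (simp add: mixture_row_def)
  also have "\<dots> = prob (Y k -` {..t} \<inter> space P)"
    by (simp add: cdf_def measure_distr)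
  finally have "truncated_df F\<^sub>2 L t = prob (Y k -` {..t} \<inter> space P)" .
  moreover have "{\<omega> \<in> space P. t < Y k \<omega>} = space P - (Y k -` {..t} \<inter> space P)" by auto
  ultimately show ?thesis by (simp add: prob_compl)
qed

text \<open>
  Truncation divides \<open>F\<^sub>2\<close> by a number at most \<open>1\<close>, so it only makes large values less likely; the
  tail estimates for \<open>F\<^sub>2\<close> therefore hold for \<open>Y k\<close> uniformly in the level \<open>L\<close>.
\<close>

lemma Y_tail: "k \<in> {1..n} \<Longrightarrow> prob {\<omega> \<in> space P. t < Y k \<omega>} \<le> 1 - F\<^sub>2 t"
  using L F2_bounds(1,2)[of t] F2_bounds(2)[of L] mult_left_mono[of "F\<^sub>2 L" 1 "F\<^sub>2 t"]
  by (auto simp: prob_Y_gt truncated_df_def field_simps)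

lemma Y_range:
  assumes k: "k \<in> {1..n}"
  shows "AE \<omega> in P. 0 \<le> Y k \<omega>" "AE \<omega> in P. Y k \<omega> \<le> L" "integrable P (Y k)"
proof -
  note [measurable] = Y_measurable[OF k]
  have "prob {\<omega> \<in> space P. 0 < Y k \<omega>} = 1"
    using L F2_bounds(3)[of 0] by (simp add: prob_Y_gt[OF k] truncated_df_def)
  from AE_prob_1[OF this] show nonneg: "AE \<omega> in P. 0 \<le> Y k \<omega>"
    by auto
  have "prob {\<omega> \<in> space P. L < Y k \<omega>} = 0"
    using L by (simp add: prob_Y_gt[OF k] truncated_df_def)
  then show le: "AE \<omega> in P. Y k \<omega> \<le> L"
    by (subst (asm) prob_eq_0) (auto simp: not_less)
  show "integrable P (Y k)"
    by (rule integrable_const_bound[of _ L]) (use nonneg le in auto)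
qed

lemma Y_identically_distributed:
  assumes k: "k \<in> {1..n}" and [measurable]: "f \<in> borel_measurable borel"
  shows "expectation (\<lambda>\<omega>. f (Y k \<omega>)) = expectation (\<lambda>\<omega>. f (Y 1 \<omega>) :: real)"
proof -
  have 1: "1 \<in> {1..n}" using n by simp
  note [measurable] = Y_measurable[OF k] Y_measurable[OF 1]
  have "distr P borel (Y k) = distr P borel (Y 1)"
    using row k 1 by (intro cdf_unique) (auto simp: mixture_row_def)
  then have "(\<integral>x. f x \<partial>distr P borel (Y k)) = (\<integral>x. f x \<partial>distr P borel (Y 1))" by simp
  then show ?thesis by (simp add: integral_distr)
qed

text \<open>
  A Bernoulli factor multiplies expectations by \<open>\<epsilon>\<close>, in every row index \<open>k\<close> alike, which is why the
  right-hand side can refer to \<open>Y 1\<close>.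
\<close>

lemma B_mult_Y:
  assumes k: "k \<in> {1..n}" and [measurable]: "f \<in> borel_measurable borel"
    and "integrable P (\<lambda>\<omega>. f (Y k \<omega>))"
  shows "integrable P (\<lambda>\<omega>. B k \<omega> * f (Y k \<omega>))"
    and "expectation (\<lambda>\<omega>. B k \<omega> * f (Y k \<omega>)) = \<epsilon> * expectation (\<lambda>\<omega>. f (Y 1 \<omega>))"
  using indep_vars_expectation_mult[OF indep index_mem(3,2)[OF k], of "\<lambda>x. x" f]
    assms B_moments[OF k] Y_identically_distributed[OF k, of f] by auto

lemma B_mult_X:
  assumes k: "k \<in> {1..n}"
  shows "integrable P (\<lambda>\<omega>. B k \<omega> * X k \<omega>)"
    and "expectation (\<lambda>\<omega>. B k \<omega> * X k \<omega>) = \<epsilon> * \<mu>"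
  using indep_vars_expectation_mult[OF indep index_mem(3,1)[OF k], of "\<lambda>x. x" "\<lambda>x. x"]
    assms B_moments[OF k] X_moments[OF k] by auto

lemma Z_mean:
  assumes k: "k \<in> {1..n}"
  shows "expectation (Z k) = (1 - \<epsilon>) * \<mu> + \<epsilon> * \<nu>"
proof -
  have "Z k = (\<lambda>\<omega>. X k \<omega> - B k \<omega> * X k \<omega> + B k \<omega> * Y k \<omega>)"
    by (simp add: Z_def fun_eq_iff algebra_simps)
  then show ?thesis
    using X_moments[OF k] B_mult_X[OF k] B_mult_Y[OF k, of "\<lambda>x. x"] Y_range[OF k]
    by (simp add: \<nu>_def algebra_simps)
qed

text \<open>
  Since \<open>B k\<close> is \<open>0\<close> or \<open>1\<close>, the square of the mixture is the mixture of the squares, and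
  \<open>0 \<le> Y k \<le> L\<close> bounds the square of \<open>Y k\<close> by \<open>L * Y k\<close>. For a power tail with \<open>\<alpha> < 1\<close> this loses
  only a constant factor, because \<open>\<nu>\<close> is of the order of \<open>L powr (1 - \<alpha>)\<close>.
\<close>

lemma Z_second_moment:
  assumes k: "k \<in> {1..n}"
  shows "integrable P (\<lambda>\<omega>. (Z k \<omega>)\<^sup>2)"
    and "expectation (\<lambda>\<omega>. (Z k \<omega>)\<^sup>2) \<le> (\<integral>x. x\<^sup>2 \<partial>D) + L * (\<epsilon> * \<nu>)"
proof -
  note [measurable] = Z_measurable[OF k]
  define h where "h = (\<lambda>\<omega>. (X k \<omega>)\<^sup>2 + L * (B k \<omega> * Y k \<omega>))"
  have h: "integrable P h" "expectation h = (\<integral>x. x\<^sup>2 \<partial>D) + L * (\<epsilon> * \<nu>)"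
    using X_moments[OF k] B_mult_Y[OF k, of "\<lambda>x. x"] Y_range[OF k] by (simp_all add: h_def \<nu>_def)
  have le: "AE \<omega> in P. (Z k \<omega>)\<^sup>2 \<le> h \<omega>"
    using B_moments(1)[OF k] Y_range(1,2)[OF k]
  proof eventually_elim
    case (elim \<omega>)
    then show ?case
      using mult_right_mono[of "Y k \<omega>" L "Y k \<omega>"] L
      by (auto simp: Z_def h_def power2_eq_square add_increasing)
  qed
  show sq: "integrable P (\<lambda>\<omega>. (Z k \<omega>)\<^sup>2)"
    by (rule Bochner_Integration.integrable_bound[OF h(1)]) (use le in auto)
  show "expectation (\<lambda>\<omega>. (Z k \<omega>)\<^sup>2) \<le> (\<integral>x. x\<^sup>2 \<partial>D) + L * (\<epsilon> * \<nu>)"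
    using integral_mono_AE[OF sq h(1) le] h(2) by simp
qed

text \<open>
  How far the contaminated sum can be from the sum of the \<open>X k\<close>. Call a contaminating value huge if it
  exceeds \<open>T\<close>. The expected number of huge values actually used is \<open>n * \<epsilon> * prob (Y 1 > T)\<close>, which
  bounds the probability that there is one. If there is none, every contaminated index \<open>k\<close> changes
  the sum by at most \<open>X k + min (Y k) T\<close>, and Markov's inequality handles the total. The level \<open>T\<close> is
  free rather than equal to \<open>L\<close>, because when \<open>L\<close> is much larger than \<open>n\<close> the values up to \<open>L\<close>
  can have too large a mean.
\<close>

lemma contamination_prob_le:
  fixes \<delta> T :: real
  assumes "0 < \<delta>" "0 \<le> T"
  shows "prob {\<omega> \<in> space P. \<bar>(\<Sum>k=1..n. Z k \<omega>) - (\<Sum>k=1..n. X k \<omega>)\<bar> > \<delta> * n}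
    \<le> \<epsilon> * (\<mu> + expectation (\<lambda>\<omega>. min (Y 1 \<omega>) T)) / \<delta>
      + n * \<epsilon> * prob {\<omega> \<in> space P. T < Y 1 \<omega>}"
proof -
  have rv [measurable]: "random_variable borel (X k)" "random_variable borel (Y k)"
    "random_variable borel (B k)" "random_variable borel (Z k)" if "k \<in> {1..n}" for k
    using random_variables[OF that] Z_measurable[OF that] by auto
  define J :: "real \<Rightarrow> real" where "J = indicator {T<..}"
  have [measurable]: "J \<in> borel_measurable borel" by (simp add: J_def)
  \<comment> \<open>\<open>R\<close> bounds the total change if no used value is huge, and \<open>Q\<close> counts the huge values used.\<close>
  define R where "R \<omega> = (\<Sum>k=1..n. B k \<omega> * X k \<omega> + B k \<omega> * min (Y k \<omega>) T)" for \<omega>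
  define Q where "Q \<omega> = (\<Sum>k=1..n. B k \<omega> * J (Y k \<omega>))" for \<omega>
  have int_min: "integrable P (\<lambda>\<omega>. min (Y k \<omega>) T)" and int_J: "integrable P (\<lambda>\<omega>. J (Y k \<omega>))"
    if k: "k \<in> {1..n}" for k
  proof -
    note [measurable] = rv[OF k]
    show "integrable P (\<lambda>\<omega>. min (Y k \<omega>) T)"
      by (rule integrable_const_bound[of _ T]) (use Y_range(1)[OF k] assms in auto)
    show "integrable P (\<lambda>\<omega>. J (Y k \<omega>))"
      by (rule integrable_const_bound[of _ 1]) (auto simp: J_def indicator_def)
  qed
  have J: "expectation (\<lambda>\<omega>. J (Y 1 \<omega>)) = prob {\<omega> \<in> space P. T < Y 1 \<omega>}"
  proof -
    have "expectation (\<lambda>\<omega>. J (Y 1 \<omega>)) = expectation (indicator {\<omega> \<in> space P. T < Y 1 \<omega>})"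
      by (intro Bochner_Integration.integral_cong) (auto simp: J_def indicator_def)
    then show ?thesis using rv[of 1] n by (simp add: Int_absorb1)
  qed
  have intR: "integrable P R" and ER: "expectation R = n * (\<epsilon> * (\<mu> + expectation (\<lambda>\<omega>. min (Y 1 \<omega>) T)))"
    unfolding R_def using B_mult_X B_mult_Y[OF _ _ int_min]
    by (auto simp: algebra_simps intro!: Bochner_Integration.integrable_sum)
  have intQ: "integrable P Q" and EQ: "expectation Q = n * \<epsilon> * prob {\<omega> \<in> space P. T < Y 1 \<omega>}"
    unfolding Q_def using B_mult_Y[OF _ _ int_J]
    by (auto simp: J algebra_simps intro!: Bochner_Integration.integrable_sum)
  have good: "AE \<omega> in P. \<forall>k\<in>{1..n}. B k \<omega> \<in> {0, 1} \<and> 0 \<le> X k \<omega> \<and> 0 \<le> Y k \<omega>"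
    using B_moments(1) X_moments(1) Y_range(1) by (intro AE_ball_countable') auto
  have R0: "AE \<omega> in P. 0 \<le> R \<omega>"
    using good by eventually_elim (use assms in \<open>auto simp: R_def intro!: sum_nonneg\<close>)
  have Q0: "AE \<omega> in P. 0 \<le> Q \<omega>"
    using good
  proof eventually_elim
    case (elim \<omega>)
    then have "0 \<le> B k \<omega>" if "k \<in> {1..n}" for k using that by fastforce
    then show ?case
      unfolding Q_def J_def by (intro sum_nonneg mult_nonneg_nonneg) auto
  qed
  let ?A = "{\<omega> \<in> space P. \<bar>(\<Sum>k=1..n. Z k \<omega>) - (\<Sum>k=1..n. X k \<omega>)\<bar> > \<delta> * n}"
  let ?R = "{\<omega> \<in> space P. R \<omega> \<ge> \<delta> * n}" and ?Q = "{\<omega> \<in> space P. Q \<omega> \<ge> 1}"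
  have sets: "?R \<in> events" "?Q \<in> events"
    using intR intQ by (auto intro!: borel_measurable_le)
  have "AE \<omega> in P. \<omega> \<in> ?A \<longrightarrow> \<omega> \<in> ?R \<union> ?Q"
    using good AE_space
  proof eventually_elim
    case (elim \<omega>)
    show ?case
    proof (intro impI, rule ccontr)
      assume A: "\<omega> \<in> ?A" and "\<omega> \<notin> ?R \<union> ?Q"
      with elim have R: "R \<omega> < \<delta> * n" and Q: "Q \<omega> < 1" by auto
      \<comment> \<open>\<open>Q\<close> is a sum of zeros and ones below \<open>1\<close>, so no huge value is used.\<close>
      have small: "\<bar>Z k \<omega> - X k \<omega>\<bar> \<le> B k \<omega> * X k \<omega> + B k \<omega> * min (Y k \<omega>) T" if k: "k \<in> {1..n}" for k
      proof -
        have "B k \<omega> * J (Y k \<omega>) \<le> Q \<omega>"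
          unfolding Q_def using elim(1) k by (intro member_le_sum) (fastforce simp: J_def indicator_def)+
        with Q have "B k \<omega> * J (Y k \<omega>) < 1" by simp
        then have "B k \<omega> = 0 \<or> Y k \<omega> \<le> T"
          using bspec[OF elim(1) k] by (auto simp: J_def indicator_def split: if_splits)
        then show ?thesis
          using bspec[OF elim(1) k] assms(2) by (auto simp: Z_def min_def)
      qed
      have "\<bar>(\<Sum>k=1..n. Z k \<omega>) - (\<Sum>k=1..n. X k \<omega>)\<bar> \<le> (\<Sum>k=1..n. \<bar>Z k \<omega> - X k \<omega>\<bar>)"
        by (simp flip: sum_subtractf)
      also have "\<dots> \<le> R \<omega>"
        unfolding R_def by (intro sum_mono small)
      finally show False using A R by simp
    qed
  qed
  then have "prob ?A \<le> prob (?R \<union> ?Q)"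
    by (intro finite_measure_mono_AE sets.Un sets) (auto simp: le_fun_def)
  also have "\<dots> \<le> prob ?R + prob ?Q"
    using sets by (rule measure_Un_le)
  also have "prob ?R \<le> expectation R / (\<delta> * n)"
    using assms n R0 by (intro integral_Markov_inequality_measure[OF intR, of "space P"]) auto
  also have "expectation R / (\<delta> * n) = \<epsilon> * (\<mu> + expectation (\<lambda>\<omega>. min (Y 1 \<omega>) T)) / \<delta>"
    using n by (simp add: ER)
  also have "prob ?Q \<le> expectation Q / 1"
    using Q0 by (intro integral_Markov_inequality_measure[OF intQ]) auto
  finally show ?thesis by (simp add: EQ)
qed

lemma truncated_mean_upper:
  assumes tail: "\<And>x. 0 < x \<Longrightarrow> 1 - F\<^sub>2 x \<le> C * x powr (- \<alpha>)" and "0 \<le> C" "\<alpha> < 1" "0 \<le> T"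
  shows "expectation (\<lambda>\<omega>. min (Y 1 \<omega>) T) \<le> C / (1 - \<alpha>) * T powr (1 - \<alpha>)"
proof -
  have 1: "1 \<in> {1..n}" using n by simp
  show ?thesis
  proof (rule expectation_min_le_of_power_tail[OF Y_measurable[OF 1] Y_range(1)[OF 1]])
    show "prob {\<omega> \<in> space P. t < Y 1 \<omega>} \<le> C * t powr (- \<alpha>)" if "0 < t" for t
      using Y_tail[OF 1, of t] tail[OF that] by linarith
  qed (use assms in auto)
qed

lemma \<nu>_upper:
  assumes "\<And>x. 0 < x \<Longrightarrow> 1 - F\<^sub>2 x \<le> C * x powr (- \<alpha>)" "0 \<le> C" "\<alpha> < 1"
  shows "\<nu> \<le> C / (1 - \<alpha>) * L powr (1 - \<alpha>)"
proof -
  have 1: "1 \<in> {1..n}" using n by simp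
  note [measurable] = Y_measurable[OF 1]
  have "\<nu> = expectation (\<lambda>\<omega>. min (Y 1 \<omega>) L)"
    unfolding \<nu>_def using Y_range(2)[OF 1] by (intro integral_cong_AE) (auto simp: min_def)
  also have "\<dots> \<le> C / (1 - \<alpha>) * L powr (1 - \<alpha>)"
    using assms L by (intro truncated_mean_upper) auto
  finally show ?thesis .
qed

text \<open>
  Markov's inequality read backwards: \<open>Y 1\<close> exceeds \<open>\<theta> * L\<close> with probability at least
  \<open>L powr (- \<alpha>)\<close>, so its mean is at least \<open>\<theta> * L\<close> times that.
\<close>

lemma \<nu>_lower:
  assumes \<theta>: "0 < \<theta>" "\<theta> < 1" and incr: "L powr (- \<alpha>) \<le> F\<^sub>2 L - F\<^sub>2 (\<theta> * L)"
  shows "\<theta> * L powr (1 - \<alpha>) \<le> \<nu>"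
proof -
  have 1: "1 \<in> {1..n}" using n by simp
  note [measurable] = Y_measurable[OF 1]
  have "\<theta> * L \<le> L" using \<theta> L by simp
  have "L powr (- \<alpha>) \<le> F\<^sub>2 L - F\<^sub>2 (\<theta> * L)" by fact
  also have "\<dots> \<le> (F\<^sub>2 L - F\<^sub>2 (\<theta> * L)) / F\<^sub>2 L"
    using L F2_bounds(2)[of L] order_trans[OF powr_ge_zero incr]
      mult_left_mono[of "F\<^sub>2 L" 1 "F\<^sub>2 L - F\<^sub>2 (\<theta> * L)"] by (simp add: pos_le_divide_eq)
  also have "\<dots> = prob {\<omega> \<in> space P. \<theta> * L < Y 1 \<omega>}"
    using L \<open>\<theta> * L \<le> L\<close> by (simp add: prob_Y_gt[OF 1] truncated_df_def diff_divide_distrib)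
  also have "\<dots> \<le> prob {\<omega> \<in> space P. \<theta> * L \<le> Y 1 \<omega>}"
    by (intro finite_measure_mono) auto
  also have "\<dots> \<le> \<nu> / (\<theta> * L)"
    unfolding \<nu>_def using Y_range[OF 1] \<theta> L
    by (intro integral_Markov_inequality_measure[of _ _ "space P"]) auto
  finally have "\<theta> * L * L powr (- \<alpha>) \<le> \<nu>"
    using \<theta> L by (simp add: field_simps)
  then show ?thesis
    using L powr_add[of L 1 "- \<alpha>"] by (simp add: mult.assoc)
qed

end

section \<open>Convergence in probability along an array\<close>

lemma measure_tendsto_0_le:
  fixes u :: "nat \<Rightarrow> real"
  assumes "\<forall>\<^sub>F n in sequentially. measure (P n) (A n) \<le> u n" "u \<longlonglongrightarrow> 0"
  shows "(\<lambda>n. measure (P n) (A n)) \<longlonglongrightarrow> 0"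
  by (rule tendsto_sandwich[OF _ assms(1) tendsto_const assms(2)]) simp

lemma conv_in_prob_const_add:
  assumes prob: "\<forall>\<^sub>F n in sequentially. prob_space (P n)"
    and U: "conv_in_prob_const P U a" and W: "conv_in_prob_const P W b"
  shows "conv_in_prob_const P (\<lambda>n \<omega>. U n \<omega> + W n \<omega>) (a + b)"
  unfolding conv_in_prob_const_def
proof (intro conjI allI impI)
  have meas: "\<forall>\<^sub>F n in sequentially. U n \<in> borel_measurable (P n) \<and> W n \<in> borel_measurable (P n)"
    using U W by (auto simp: conv_in_prob_const_def eventually_conj_iff)
  then show "\<forall>\<^sub>F n in sequentially. (\<lambda>\<omega>. U n \<omega> + W n \<omega>) \<in> borel_measurable (P n)"
    by eventually_elim auto
  fix \<delta> :: real
  assume "0 < \<delta>"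
  let ?u = "\<lambda>n. measure (P n) {\<omega> \<in> space (P n). \<bar>U n \<omega> - a\<bar> > \<delta> / 2}"
  let ?w = "\<lambda>n. measure (P n) {\<omega> \<in> space (P n). \<bar>W n \<omega> - b\<bar> > \<delta> / 2}"
  have "0 < \<delta> / 2" using \<open>0 < \<delta>\<close> by simp
  then have "?u \<longlonglongrightarrow> 0" "?w \<longlonglongrightarrow> 0"
    using U W unfolding conv_in_prob_const_def by blast+
  then have lim: "(\<lambda>n. ?u n + ?w n) \<longlonglongrightarrow> 0"
    by (rule tendsto_add_zero)
  have "\<forall>\<^sub>F n in sequentially.
      measure (P n) {\<omega> \<in> space (P n). \<bar>U n \<omega> + W n \<omega> - (a + b)\<bar> > \<delta>} \<le> ?u n + ?w n"
    using prob meas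
  proof eventually_elim
    case (elim n)
    then interpret prob_space "P n" by simp
    from elim have [measurable]: "random_variable borel (U n)" "random_variable borel (W n)" by auto
    have "prob {\<omega> \<in> space (P n). \<bar>U n \<omega> + W n \<omega> - (a + b)\<bar> > \<delta>}
        \<le> prob ({\<omega> \<in> space (P n). \<bar>U n \<omega> - a\<bar> > \<delta> / 2} \<union> {\<omega> \<in> space (P n). \<bar>W n \<omega> - b\<bar> > \<delta> / 2})"
    proof (rule finite_measure_mono)
      have "\<bar>U n \<omega> - a\<bar> > \<delta> / 2 \<or> \<bar>W n \<omega> - b\<bar> > \<delta> / 2"
        if "\<bar>U n \<omega> + W n \<omega> - (a + b)\<bar> > \<delta>" for \<omega>
        using that by linarith
      then show "{\<omega> \<in> space (P n). \<bar>U n \<omega> + W n \<omega> - (a + b)\<bar> > \<delta>}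
          \<subseteq> {\<omega> \<in> space (P n). \<bar>U n \<omega> - a\<bar> > \<delta> / 2} \<union> {\<omega> \<in> space (P n). \<bar>W n \<omega> - b\<bar> > \<delta> / 2}"
        by blast
    qed measurable
    also have "\<dots> \<le> ?u n + ?w n"
      by (intro measure_Un_le) auto
    finally show ?case .
  qed
  then show "(\<lambda>n. measure (P n) {\<omega> \<in> space (P n). \<bar>U n \<omega> + W n \<omega> - (a + b)\<bar> > \<delta>}) \<longlonglongrightarrow> 0"
    using lim by (rule measure_tendsto_0_le)
qed

lemma conv_in_prob_const_mult_tendsto:
  assumes prob: "\<forall>\<^sub>F n in sequentially. prob_space (P n)"
    and W: "conv_in_prob_const P W b" and c: "c \<longlonglongrightarrow> a"
  shows "conv_in_prob_const P (\<lambda>n \<omega>. c n * W n \<omega>) (a * b)"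
  unfolding conv_in_prob_const_def
proof (intro conjI allI impI)
  have meas: "\<forall>\<^sub>F n in sequentially. W n \<in> borel_measurable (P n)"
    using W by (auto simp: conv_in_prob_const_def)
  then show "\<forall>\<^sub>F n in sequentially. (\<lambda>\<omega>. c n * W n \<omega>) \<in> borel_measurable (P n)"
    by eventually_elim auto
  fix \<delta> :: real
  assume "0 < \<delta>"
  define K where "K = \<bar>a\<bar> + 1"
  have "0 < K" by (simp add: K_def)
  let ?w = "\<lambda>n. measure (P n) {\<omega> \<in> space (P n). \<bar>W n \<omega> - b\<bar> > \<delta> / (2 * K)}"
  have "0 < \<delta> / (2 * K)" using \<open>0 < \<delta>\<close> \<open>0 < K\<close> by simp
  then have w: "?w \<longlonglongrightarrow> 0"
    using W unfolding conv_in_prob_const_def by blast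
  have lims: "(\<lambda>n. \<bar>c n\<bar>) \<longlonglongrightarrow> \<bar>a\<bar>" "(\<lambda>n. \<bar>(c n - a) * b\<bar>) \<longlonglongrightarrow> \<bar>(a - a) * b\<bar>"
    by (intro tendsto_intros c)+
  have "\<forall>\<^sub>F n in sequentially. \<bar>c n\<bar> < K"
    by (rule order_tendstoD(2)[OF lims(1)]) (simp add: K_def)
  moreover have "\<forall>\<^sub>F n in sequentially. \<bar>(c n - a) * b\<bar> < \<delta> / 2"
    by (rule order_tendstoD(2)[OF lims(2)]) (use \<open>0 < \<delta>\<close> in simp)
  ultimately have "\<forall>\<^sub>F n in sequentially.
      measure (P n) {\<omega> \<in> space (P n). \<bar>c n * W n \<omega> - a * b\<bar> > \<delta>} \<le> ?w n"
    using prob meas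
  proof eventually_elim
    case (elim n)
    then interpret prob_space "P n" by simp
    have "\<bar>W n \<omega> - b\<bar> > \<delta> / (2 * K)" if "\<bar>c n * W n \<omega> - a * b\<bar> > \<delta>" for \<omega>
    proof (rule ccontr)
      assume "\<not> ?thesis"
      then have "\<bar>c n\<bar> * \<bar>W n \<omega> - b\<bar> \<le> K * (\<delta> / (2 * K))"
        using elim \<open>0 < K\<close> by (intro mult_mono) auto
      then have "\<bar>c n * (W n \<omega> - b)\<bar> \<le> \<delta> / 2"
        using \<open>0 < K\<close> by (simp add: abs_mult)
      moreover have "c n * W n \<omega> - a * b = c n * (W n \<omega> - b) + (c n - a) * b"
        by (simp add: algebra_simps)
      ultimately show False using elim that by linarith
    qed
    with elim show ?case
      by (intro finite_measure_mono) auto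
  qed
  then show "(\<lambda>n. measure (P n) {\<omega> \<in> space (P n). \<bar>c n * W n \<omega> - a * b\<bar> > \<delta>}) \<longlonglongrightarrow> 0"
    using w by (rule measure_tendsto_0_le)
qed

lemma conv_in_prob_const_change_normalisation:
  assumes prob: "\<forall>\<^sub>F n in sequentially. prob_space (P n)"
    and S: "conv_in_prob_const P (\<lambda>n \<omega>. S n \<omega> / (real n * m)) 1"
    and e: "e \<longlonglongrightarrow> m" and m: "m \<noteq> 0"
  shows "conv_in_prob_const P (\<lambda>n \<omega>. S n \<omega> / (real n * e n)) 1"
proof -
  have "(\<lambda>n. m / e n) \<longlonglongrightarrow> m / m"
    using e m by (intro tendsto_intros)
  from conv_in_prob_const_mult_tendsto[OF prob S this] show ?thesis
    using m by (simp add: mult.commute)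
qed

text \<open>
  The criterion \<open>v n / (n * (m n)\<^sup>2) \<rightarrow> 0\<close> makes no difference between a mean that stays bounded and
  one that diverges; it serves both for the light-tailed sum and for the contaminated one.
\<close>

lemma relative_weak_law:
  assumes row: "\<forall>\<^sub>F n in sequentially. prob_space (P n)
      \<and> prob_space.indep_vars (P n) (\<lambda>_. borel) (W n) {1..n}
      \<and> (\<forall>k\<in>{1..n}. integrable (P n) (\<lambda>\<omega>. (W n k \<omega>)\<^sup>2)
          \<and> prob_space.expectation (P n) (W n k) = m n
          \<and> prob_space.expectation (P n) (\<lambda>\<omega>. (W n k \<omega>)\<^sup>2) \<le> v n)
      \<and> 0 < m n"
    and ratio: "(\<lambda>n. v n / (real n * (m n)\<^sup>2)) \<longlonglongrightarrow> 0"
  shows "conv_in_prob_const P (\<lambda>n \<omega>. (\<Sum>k=1..n. W n k \<omega>) / (real n * m n)) 1"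
  unfolding conv_in_prob_const_def
proof (intro conjI allI impI)
  show "\<forall>\<^sub>F n in sequentially. (\<lambda>\<omega>. (\<Sum>k=1..n. W n k \<omega>) / (real n * m n)) \<in> borel_measurable (P n)"
    using row
  proof eventually_elim
    case (elim n)
    then interpret prob_space "P n" by simp
    have "random_variable borel (W n k)" if "k \<in> {1..n}" for k
      using elim that by (auto simp: indep_vars_def)
    then have "random_variable borel (\<lambda>\<omega>. \<Sum>k=1..n. W n k \<omega>)"
      by (rule borel_measurable_sum)
    then show ?case by simp
  qed
  fix \<delta> :: real
  assume "0 < \<delta>"
  have "\<forall>\<^sub>F n in sequentially. measure (P n)
      {\<omega> \<in> space (P n). \<bar>(\<Sum>k=1..n. W n k \<omega>) / (real n * m n) - 1\<bar> > \<delta>}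
        \<le> v n / (real n * (m n)\<^sup>2) / \<delta>\<^sup>2"
    using row eventually_gt_at_top[of 0]
  proof eventually_elim
    case (elim n)
    then interpret prob_space "P n" by simp
    show ?case
      using relative_chebyshev_sum[of "{1..n}" "W n" "m n" "v n" \<delta>] elim \<open>0 < \<delta>\<close> by auto
  qed
  moreover have "(\<lambda>n. v n / (real n * (m n)\<^sup>2) / \<delta>\<^sup>2) \<longlonglongrightarrow> 0"
    using tendsto_divide[OF ratio tendsto_const[of "\<delta>\<^sup>2"]] \<open>0 < \<delta>\<close> by simp
  ultimately show "(\<lambda>n. measure (P n)
      {\<omega> \<in> space (P n). \<bar>(\<Sum>k=1..n. W n k \<omega>) / (real n * m n) - 1\<bar> > \<delta>}) \<longlonglongrightarrow> 0"
    by (rule measure_tendsto_0_le)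
qed

section \<open>The three regimes\<close>

theorem theorem2p2:
  fixes \<alpha> \<gamma>\<^sub>1 \<gamma>\<^sub>2 lam :: real
    and F\<^sub>1 F\<^sub>2 :: "real \<Rightarrow> real"
    and M \<epsilon> :: "nat \<Rightarrow> real"
    and P :: "nat \<Rightarrow> 'a measure"
    and X Y B Z :: "nat \<Rightarrow> nat \<Rightarrow> 'a \<Rightarrow> real"
    and S :: "nat \<Rightarrow> 'a \<Rightarrow> real"
  assumes \<alpha>: "0 < \<alpha>" "\<alpha> < 1"
    and \<gamma>: "0 < \<gamma>\<^sub>1" "0 < \<gamma>\<^sub>2"
    and lam: "0 < lam"
    and F1: "dist_fun_on {0..} F\<^sub>1"
    and F1_tail: "(\<lambda>x. 1 - F\<^sub>1 x) \<sim>[at_top] (\<lambda>x. exp (- lam * x))"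
    and F2: "dist_fun_on {1..} F\<^sub>2"
    and F2_tail: "(\<lambda>x. 1 - F\<^sub>2 x) \<sim>[at_top] (\<lambda>x. x powr (- \<alpha>))"
    and M: "\<And>n. M n = real n powr \<gamma>\<^sub>1"
    and \<epsilon>: "\<And>n. \<epsilon> n = real n powr (- \<gamma>\<^sub>2)"
    and row: "\<forall>\<^sub>F n in sequentially. mixture_row F\<^sub>1 F\<^sub>2 (M n) (\<epsilon> n) n (P n) (X n) (Y n) (B n)"
    and Z: "\<And>n k \<omega>. Z n k \<omega> = (1 - B n k \<omega>) * X n k \<omega> + B n k \<omega> * Y n k \<omega>"
    and S: "\<And>n \<omega>. S n \<omega> = (\<Sum>k=1..n. Z n k \<omega>)"
  shows
    "(\<gamma>\<^sub>2 > (1 - \<alpha>) * \<gamma>\<^sub>1 \<or> \<gamma>\<^sub>2 < min ((1 - \<alpha>) * \<gamma>\<^sub>1) (1 - \<alpha> * \<gamma>\<^sub>1) \<longrightarrow>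
        conv_in_prob_const P (\<lambda>n \<omega>. S n \<omega> / (real n * prob_space.expectation (P n) (Z n 1))) 1)
     \<and>
     (\<gamma>\<^sub>2 > 1 - \<alpha> \<and> \<gamma>\<^sub>2 \<in> {1 - \<alpha> <..< (1 - \<alpha>) * \<gamma>\<^sub>1} \<longrightarrow>
        conv_in_prob_const P (\<lambda>n \<omega>. S n \<omega> / (real n * prob_space.expectation (P n) (X n 1))) 1)"
proof -
  obtain D where D: "real_distribution D" "measure D {0..} = 1" "cdf D = F\<^sub>1"
    using F1 by (auto simp: dist_fun_on_def)
  interpret D: real_distribution D by fact
  define m where "m = (\<integral>x. x \<partial>D)"
  define v where "v = (\<integral>x. x\<^sup>2 \<partial>D)"
  define y where "y n = prob_space.expectation (P n) (Y n 1)" for n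
  have D_sq: "integrable D (\<lambda>x. x\<^sup>2)" and m: "0 < m"
    using exponential_tail_moments[OF D(1,2) _ lam] F1_tail D(3) by (simp_all add: m_def)
  have v: "0 \<le> v" by (simp add: v_def)
  obtain E where E: "real_distribution E" "cdf E = F\<^sub>2"
    using F2 by (auto simp: dist_fun_on_def)
  have F2_nonneg: "0 \<le> F\<^sub>2 x" for x
    using E by (auto simp: cdf_def)
  obtain C where C: "0 < C" "\<And>x. 0 < x \<Longrightarrow> 1 - F\<^sub>2 x \<le> C * x powr (- \<alpha>)"
    using power_tail_upper[OF F2_tail \<alpha>(1) F2_nonneg] by blast
  obtain \<theta> where \<theta>: "0 < \<theta>" "\<theta> < 1" and incr: "\<forall>\<^sub>F x in at_top. x powr (- \<alpha>) \<le> F\<^sub>2 x - F\<^sub>2 (\<theta> * x)"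
    using power_tail_increment[OF F2_tail \<alpha>(1)] by blast
  have nat_powr: "(\<lambda>n. real n powr s) \<longlonglongrightarrow> 0" if "s < 0" for s
    using that by (intro tendsto_neg_powr filterlim_real_sequentially)
  have M_top: "filterlim M at_top sequentially"
    unfolding M using \<gamma>(1) by real_asymp
  have \<epsilon>_0: "\<epsilon> \<longlonglongrightarrow> 0"
    unfolding \<epsilon> using \<gamma>(2) by (intro nat_powr) simp
  have "(F\<^sub>2 \<longlongrightarrow> 1) at_top"
    using real_distribution.cdf_lim_at_top_prob[OF E(1)] E(2) by simp
  then have "(\<lambda>n. F\<^sub>2 (M n)) \<longlonglongrightarrow> 1"
    using M_top by (rule filterlim_compose)
  then have "\<forall>\<^sub>F n in sequentially. 0 < F\<^sub>2 (M n)"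
    by (rule order_tendstoD(1)) simp
  moreover have "\<forall>\<^sub>F n in sequentially. M n powr (- \<alpha>) \<le> F\<^sub>2 (M n) - F\<^sub>2 (\<theta> * M n)"
    by (rule eventually_compose_filterlim[OF incr M_top])
  moreover have "\<forall>\<^sub>F n in sequentially. \<epsilon> n < 1"
    by (rule order_tendstoD(2)[OF \<epsilon>_0]) simp
  ultimately have rows: "\<forall>\<^sub>F n in sequentially. 0 < n
      \<and> contaminated_row (P n) F\<^sub>1 F\<^sub>2 (M n) (\<epsilon> n) n (X n) (Y n) (B n) D
      \<and> M n powr (- \<alpha>) \<le> F\<^sub>2 (M n) - F\<^sub>2 (\<theta> * M n)"
    using row eventually_gt_at_top[of 0]
  proof eventually_elim
    case (elim n)
    have "prob_space (P n)" using elim by (simp add: mixture_row_def)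
    moreover have "AE x in D. 0 \<le> x" using D.AE_prob_1[OF D(2)] by simp
    moreover have "0 < M n" "0 \<le> \<epsilon> n" using elim by (simp_all add: M \<epsilon>)
    ultimately show ?case
      using elim D D_sq F2 by (simp add: contaminated_row_def contaminated_row_axioms_def)
  qed
  have facts: "\<forall>\<^sub>F n in sequentially. prob_space (P n)
      \<and> prob_space.indep_vars (P n) (\<lambda>_. borel) (X n) {1..n}
      \<and> prob_space.indep_vars (P n) (\<lambda>_. borel) (Z n) {1..n}
      \<and> (\<forall>k\<in>{1..n}. integrable (P n) (\<lambda>\<omega>. (X n k \<omega>)\<^sup>2)
          \<and> prob_space.expectation (P n) (X n k) = m
          \<and> prob_space.expectation (P n) (\<lambda>\<omega>. (X n k \<omega>)\<^sup>2) = v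
          \<and> integrable (P n) (\<lambda>\<omega>. (Z n k \<omega>)\<^sup>2)
          \<and> prob_space.expectation (P n) (Z n k) = (1 - \<epsilon> n) * m + \<epsilon> n * y n
          \<and> prob_space.expectation (P n) (\<lambda>\<omega>. (Z n k \<omega>)\<^sup>2) \<le> v + M n * (\<epsilon> n * y n))
      \<and> \<theta> * M n powr (1 - \<alpha>) \<le> y n \<and> y n \<le> C / (1 - \<alpha>) * M n powr (1 - \<alpha>)
      \<and> 0 < n \<and> 0 < M n \<and> 0 < \<epsilon> n \<and> \<epsilon> n \<le> 1"
    using rows
  proof eventually_elim
    case (elim n)
    then interpret R: contaminated_row "P n" F\<^sub>1 F\<^sub>2 "M n" "\<epsilon> n" n "X n" "Y n" "B n" D by simp
    have Zn: "Z n = R.Z" by (simp add: fun_eq_iff Z R.Z_def)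
    have "R.\<mu> = m" "R.\<nu> = y n" by (simp_all add: R.\<mu>_def R.\<nu>_def m_def y_def)
    moreover have "0 < \<epsilon> n" using R.n by (simp add: \<epsilon>)
    ultimately show ?case
      using R.prob_space_axioms R.indep_X R.indep_Z R.X_moments R.Z_mean R.Z_second_moment
        R.\<nu>_upper[OF C(2)] R.\<nu>_lower[OF \<theta>] C(1) \<alpha> R.L R.\<epsilon> elim
      by (simp add: Zn v_def)
  qed
  have prob: "\<forall>\<^sub>F n in sequentially. prob_space (P n)"
    using facts by eventually_elim simp
  have mean_Z: "\<forall>\<^sub>F n in sequentially. prob_space.expectation (P n) (Z n 1) = (1 - \<epsilon> n) * m + \<epsilon> n * y n"
    using facts by eventually_elim simp
  have \<epsilon>M: "\<epsilon> n * M n powr s = real n powr (s * \<gamma>\<^sub>1 - \<gamma>\<^sub>2)" for n s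
    by (simp add: \<epsilon> M powr_powr mult.commute flip: powr_add)

  have law_X: "conv_in_prob_const P (\<lambda>n \<omega>. (\<Sum>k=1..n. X n k \<omega>) / (real n * m)) 1"
  proof (rule relative_weak_law)
    show "(\<lambda>n. v / (real n * m\<^sup>2)) \<longlonglongrightarrow> 0" using m by real_asymp
  qed (use facts m in \<open>auto elim: eventually_mono\<close>)
  \<comment> \<open>The contamination is invisible on the scale \<open>n\<close> once some cut-off \<open>T n\<close> makes both the huge
    values unlikely and the mean of the rest small.\<close>
  have negligible: "conv_in_prob_const P (\<lambda>n \<omega>. S n \<omega> / (real n * m)) 1"
    if T: "\<And>n. 0 \<le> T n" and body: "(\<lambda>n. \<epsilon> n * T n powr (1 - \<alpha>)) \<longlonglongrightarrow> 0"
      and tail: "(\<lambda>n. real n * \<epsilon> n * measure (P n) {\<omega> \<in> space (P n). T n < Y n 1 \<omega>}) \<longlonglongrightarrow> 0"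
    for T :: "nat \<Rightarrow> real"
  proof -
    define W where "W n \<omega> = (S n \<omega> - (\<Sum>k=1..n. X n k \<omega>)) / (real n * m)" for n \<omega>
    have "conv_in_prob_const P W 0"
      unfolding conv_in_prob_const_def
    proof (intro conjI allI impI)
      show "\<forall>\<^sub>F n in sequentially. W n \<in> borel_measurable (P n)"
        using facts
      proof eventually_elim
        case (elim n)
        then interpret prob_space "P n" by simp
        have "random_variable borel (X n k)" "random_variable borel (Z n k)" if "k \<in> {1..n}" for k
          using elim that by (auto simp: indep_vars_def)
        then have "random_variable borel (\<lambda>\<omega>. \<Sum>k=1..n. X n k \<omega>)" "random_variable borel (\<lambda>\<omega>. \<Sum>k=1..n. Z n k \<omega>)"
          by (auto intro: borel_measurable_sum)
        then show ?case
          unfolding W_def[abs_def] S by simp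
      qed
      fix \<delta> :: real
      assume "0 < \<delta>"
      let ?b = "\<lambda>n. (\<epsilon> n * m + C / (1 - \<alpha>) * (\<epsilon> n * T n powr (1 - \<alpha>))) / (\<delta> * m)
        + real n * \<epsilon> n * measure (P n) {\<omega> \<in> space (P n). T n < Y n 1 \<omega>}"
      have "\<forall>\<^sub>F n in sequentially. measure (P n) {\<omega> \<in> space (P n). \<bar>W n \<omega> - 0\<bar> > \<delta>} \<le> ?b n"
        using rows
      proof eventually_elim
        case (elim n)
        then interpret R: contaminated_row "P n" F\<^sub>1 F\<^sub>2 "M n" "\<epsilon> n" n "X n" "Y n" "B n" D by simp
        have Zn: "Z n = R.Z" by (simp add: fun_eq_iff Z R.Z_def)
        have W_event: "{\<omega> \<in> space (P n). \<bar>W n \<omega> - 0\<bar> > \<delta>}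
            = {\<omega> \<in> space (P n). \<bar>(\<Sum>k=1..n. R.Z k \<omega>) - (\<Sum>k=1..n. X n k \<omega>)\<bar> > \<delta> * m * n}"
          using R.n m by (auto simp: W_def S Zn abs_mult field_simps)
        have "measure (P n) {\<omega> \<in> space (P n). \<bar>W n \<omega> - 0\<bar> > \<delta>}
            \<le> \<epsilon> n * (R.\<mu> + R.expectation (\<lambda>\<omega>. min (Y n 1 \<omega>) (T n))) / (\<delta> * m)
            + n * \<epsilon> n * measure (P n) {\<omega> \<in> space (P n). T n < Y n 1 \<omega>}"
          unfolding W_event using m \<open>0 < \<delta>\<close> T[of n]
          by (intro R.contamination_prob_le[of "\<delta> * m" "T n"]) auto
        also have "\<dots> \<le> ?b n"
        proof -
          have "R.\<mu> + R.expectation (\<lambda>\<omega>. min (Y n 1 \<omega>) (T n)) \<le> m + C / (1 - \<alpha>) * T n powr (1 - \<alpha>)"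
            using R.truncated_mean_upper[OF C(2), of "T n"] C(1) \<alpha> T[of n] by (simp add: R.\<mu>_def m_def)
          then have "\<epsilon> n * (R.\<mu> + R.expectation (\<lambda>\<omega>. min (Y n 1 \<omega>) (T n)))
              \<le> \<epsilon> n * (m + C / (1 - \<alpha>) * T n powr (1 - \<alpha>))"
            using R.\<epsilon> by (intro mult_left_mono) auto
          also have "\<dots> = \<epsilon> n * m + C / (1 - \<alpha>) * (\<epsilon> n * T n powr (1 - \<alpha>))"
            by (simp add: algebra_simps)
          finally show ?thesis
            using m \<open>0 < \<delta>\<close> by (intro add_right_mono divide_right_mono) auto
        qed
        finally show ?case .
      qed
      moreover have "?b \<longlonglongrightarrow> (0 * m + C / (1 - \<alpha>) * 0) / (\<delta> * m) + 0"
        using m \<open>0 < \<delta>\<close> by (intro tendsto_intros \<epsilon>_0 body tail) auto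
      then have "?b \<longlonglongrightarrow> 0" by simp
      ultimately show "(\<lambda>n. measure (P n) {\<omega> \<in> space (P n). \<bar>W n \<omega> - 0\<bar> > \<delta>}) \<longlonglongrightarrow> 0"
        by (rule measure_tendsto_0_le)
    qed
    from conv_in_prob_const_add[OF prob law_X this] show ?thesis
      by (simp add: W_def flip: add_divide_distrib)
  qed

  \<comment> \<open>Here \<open>\<epsilon> n * y n\<close> tends to \<open>0\<close>, and the cut-off at the truncation level itself leaves no huge values.
    The same limit turns the normalisation \<open>m\<close> into the mean of \<open>Z\<close>.\<close>
  have case_small: "conv_in_prob_const P (\<lambda>n \<omega>. S n \<omega> / (real n * prob_space.expectation (P n) (Z n 1))) 1"
    if g: "\<gamma>\<^sub>2 > (1 - \<alpha>) * \<gamma>\<^sub>1"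
  proof (rule conv_in_prob_const_change_normalisation[OF prob])
    have body: "(\<lambda>n. \<epsilon> n * M n powr (1 - \<alpha>)) \<longlonglongrightarrow> 0"
      unfolding \<epsilon>M using g by (intro nat_powr) simp
    show "conv_in_prob_const P (\<lambda>n \<omega>. S n \<omega> / (real n * m)) 1"
    proof (rule negligible[of M])
      have "\<forall>\<^sub>F n in sequentially. real n * \<epsilon> n * measure (P n) {\<omega> \<in> space (P n). M n < Y n 1 \<omega>} = 0"
        using rows
      proof eventually_elim
        case (elim n)
        then interpret R: contaminated_row "P n" F\<^sub>1 F\<^sub>2 "M n" "\<epsilon> n" n "X n" "Y n" "B n" D by simp
        show ?case
          using R.prob_Y_gt[of 1 "M n"] R.n R.L by (simp add: truncated_df_def)
      qed
      then show "(\<lambda>n. real n * \<epsilon> n * measure (P n) {\<omega> \<in> space (P n). M n < Y n 1 \<omega>}) \<longlonglongrightarrow> 0"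
        by (rule tendsto_eventually)
    qed (use body in \<open>auto simp: M\<close>)
    have "(\<lambda>n. \<epsilon> n * y n) \<longlonglongrightarrow> 0"
    proof (rule tendsto_sandwich[OF _ _ tendsto_const])
      show "\<forall>\<^sub>F n in sequentially. 0 \<le> \<epsilon> n * y n"
        using facts
      proof eventually_elim
        case (elim n)
        then have "0 \<le> \<theta> * M n powr (1 - \<alpha>)" using \<theta> by simp
        with elim show ?case by auto
      qed
      show "\<forall>\<^sub>F n in sequentially. \<epsilon> n * y n \<le> C / (1 - \<alpha>) * (\<epsilon> n * M n powr (1 - \<alpha>))"
        using facts
      proof eventually_elim
        case (elim n)
        then have "\<epsilon> n * y n \<le> \<epsilon> n * (C / (1 - \<alpha>) * M n powr (1 - \<alpha>))"
          by (intro mult_left_mono) auto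
        then show ?case by (simp add: algebra_simps)
      qed
      show "(\<lambda>n. C / (1 - \<alpha>) * (\<epsilon> n * M n powr (1 - \<alpha>))) \<longlonglongrightarrow> 0"
        by (rule tendsto_mult_right_zero[OF body])
    qed
    then have "(\<lambda>n. (1 - \<epsilon> n) * m + \<epsilon> n * y n) \<longlonglongrightarrow> (1 - 0) * m + 0"
      by (intro tendsto_intros \<epsilon>_0)
    then have "(\<lambda>n. (1 - \<epsilon> n) * m + \<epsilon> n * y n) \<longlonglongrightarrow> m" by simp
    then show "(\<lambda>n. prob_space.expectation (P n) (Z n 1)) \<longlonglongrightarrow> m"
      by (rule Lim_transform_eventually) (use mean_Z in \<open>auto elim: eventually_mono\<close>)
  qed (use m in simp)

  \<comment> \<open>Here \<open>\<epsilon> n * y n\<close>, of the order of \<open>n powr \<beta>\<close> with \<open>\<beta> > 0\<close>, dominates the mean, while the second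
    moment is at most \<open>v + M n * (\<epsilon> n * y n)\<close>. Relative to \<open>n\<close> times the squared mean its second
    term has the order of \<open>M n / (n * n powr \<beta>)\<close>, whose exponent \<open>\<gamma>\<^sub>1 - 1 - \<beta>\<close> is \<open>\<alpha> * \<gamma>\<^sub>1 + \<gamma>\<^sub>2 - 1\<close>.\<close>
  have case_large: "conv_in_prob_const P (\<lambda>n \<omega>. S n \<omega> / (real n * prob_space.expectation (P n) (Z n 1))) 1"
    if g: "\<gamma>\<^sub>2 < (1 - \<alpha>) * \<gamma>\<^sub>1" "\<gamma>\<^sub>2 < 1 - \<alpha> * \<gamma>\<^sub>1"
    unfolding S
  proof (rule relative_weak_law[where v="\<lambda>n. v + M n * (\<epsilon> n * y n)"])
    define \<beta> where "\<beta> = (1 - \<alpha>) * \<gamma>\<^sub>1 - \<gamma>\<^sub>2"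
    have lower: "\<forall>\<^sub>F n in sequentially. 0 < n \<and> 0 < M n \<and> \<theta> * real n powr \<beta> \<le> \<epsilon> n * y n
        \<and> \<epsilon> n * y n \<le> prob_space.expectation (P n) (Z n 1)"
      using facts
    proof eventually_elim
      case (elim n)
      then have "\<theta> * (\<epsilon> n * M n powr (1 - \<alpha>)) \<le> \<epsilon> n * y n"
        by (simp add: mult.left_commute)
      moreover have "0 \<le> (1 - \<epsilon> n) * m" using elim m by simp
      ultimately show ?case using elim by (simp add: \<epsilon>M \<beta>_def)
    qed
    show "\<forall>\<^sub>F n in sequentially. prob_space (P n)
      \<and> prob_space.indep_vars (P n) (\<lambda>_. borel) (Z n) {1..n}
      \<and> (\<forall>k\<in>{1..n}. integrable (P n) (\<lambda>\<omega>. (Z n k \<omega>)\<^sup>2)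
          \<and> prob_space.expectation (P n) (Z n k) = prob_space.expectation (P n) (Z n 1)
          \<and> prob_space.expectation (P n) (\<lambda>\<omega>. (Z n k \<omega>)\<^sup>2) \<le> v + M n * (\<epsilon> n * y n))
      \<and> 0 < prob_space.expectation (P n) (Z n 1)"
      using facts lower
    proof eventually_elim
      case (elim n)
      have "0 < \<theta> * real n powr \<beta>" using \<theta> elim by simp
      with elim show ?case by auto
    qed
    show "(\<lambda>n. (v + M n * (\<epsilon> n * y n)) / (real n * (prob_space.expectation (P n) (Z n 1))\<^sup>2)) \<longlonglongrightarrow> 0"
    proof (rule tendsto_sandwich[OF _ _ tendsto_const])
      let ?u = "\<lambda>n. v / \<theta>\<^sup>2 * real n powr (-1) + real n powr (\<alpha> * \<gamma>\<^sub>1 + \<gamma>\<^sub>2 - 1) / \<theta>"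
      have bounds: "\<forall>\<^sub>F n in sequentially.
          0 \<le> (v + M n * (\<epsilon> n * y n)) / (real n * (prob_space.expectation (P n) (Z n 1))\<^sup>2)
          \<and> (v + M n * (\<epsilon> n * y n)) / (real n * (prob_space.expectation (P n) (Z n 1))\<^sup>2) \<le> ?u n"
        using lower
      proof eventually_elim
        case (elim n)
        define e where "e = \<epsilon> n * y n"
        define z where "z = prob_space.expectation (P n) (Z n 1)"
        have n: "0 < real n" and "1 \<le> real n" and Mn: "0 < M n" using elim by auto
        then have "1 \<le> real n powr \<beta>" using g by (intro ge_one_powr_ge_zero) (auto simp: \<beta>_def)
        then have \<theta>_le: "\<theta> \<le> \<theta> * real n powr \<beta>" using \<theta> by simp
        with elim \<theta> have e: "\<theta> \<le> e" "\<theta> * real n powr \<beta> \<le> e" "e \<le> z" "0 < e"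
          unfolding e_def z_def by linarith+
        have "(v + M n * e) / (real n * z\<^sup>2) \<le> (v + M n * e) / (real n * e\<^sup>2)"
          using e n v Mn by (intro divide_left_mono mult_left_mono power_mono) auto
        also have "\<dots> = v / (real n * e\<^sup>2) + M n / (real n * e)"
          using e n by (simp add: add_divide_distrib power2_eq_square)
        also have "\<dots> \<le> ?u n"
        proof (rule add_mono)
          have "v / (real n * e\<^sup>2) \<le> v / (real n * \<theta>\<^sup>2)"
            using e n v \<theta> by (intro divide_left_mono mult_left_mono power_mono) auto
          then show "v / (real n * e\<^sup>2) \<le> v / \<theta>\<^sup>2 * real n powr (-1)"
            using n by (simp add: powr_minus field_simps)
          have "M n / (real n * e) \<le> M n / (real n * (\<theta> * real n powr \<beta>))"
            using e n Mn \<theta> by (intro divide_left_mono mult_left_mono) auto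
          also have "\<dots> = real n powr (\<gamma>\<^sub>1 - 1 - \<beta>) / \<theta>"
            using n by (simp add: M powr_diff powr_add field_simps)
          also have "\<gamma>\<^sub>1 - 1 - \<beta> = \<alpha> * \<gamma>\<^sub>1 + \<gamma>\<^sub>2 - 1"
            by (simp add: \<beta>_def algebra_simps)
          finally show "M n / (real n * e) \<le> real n powr (\<alpha> * \<gamma>\<^sub>1 + \<gamma>\<^sub>2 - 1) / \<theta>" .
        qed
        finally show ?case
          using e n v Mn by (simp add: e_def z_def)
      qed
      show "\<forall>\<^sub>F n in sequentially.
          0 \<le> (v + M n * (\<epsilon> n * y n)) / (real n * (prob_space.expectation (P n) (Z n 1))\<^sup>2)"
        using bounds by eventually_elim simp
      show "\<forall>\<^sub>F n in sequentially.
          (v + M n * (\<epsilon> n * y n)) / (real n * (prob_space.expectation (P n) (Z n 1))\<^sup>2) \<le> ?u n"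
        using bounds by eventually_elim simp
      have "?u \<longlonglongrightarrow> v / \<theta>\<^sup>2 * 0 + 0 / \<theta>"
        using g \<theta> by (intro tendsto_intros nat_powr) auto
      then show "?u \<longlonglongrightarrow> 0" by simp
    qed
  qed

  \<comment> \<open>Here the cut-off is \<open>n\<close>: both the expected number of contaminating values above \<open>n\<close> and the mean
    of the rest per summand are at most of the order of \<open>n powr (1 - \<alpha> - \<gamma>\<^sub>2)\<close>.\<close>
  have case_middle: "conv_in_prob_const P (\<lambda>n \<omega>. S n \<omega> / (real n * prob_space.expectation (P n) (X n 1))) 1"
    if g: "\<gamma>\<^sub>2 > 1 - \<alpha>"
  proof (rule conv_in_prob_const_change_normalisation[OF prob])
    show "conv_in_prob_const P (\<lambda>n \<omega>. S n \<omega> / (real n * m)) 1"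
    proof (rule negligible[of real])
      have "(\<lambda>n. \<epsilon> n * real n powr (1 - \<alpha>)) = (\<lambda>n. real n powr (1 - \<alpha> - \<gamma>\<^sub>2))"
        by (simp add: \<epsilon> fun_eq_iff flip: powr_add)
      then show "(\<lambda>n. \<epsilon> n * real n powr (1 - \<alpha>)) \<longlonglongrightarrow> 0"
        using g nat_powr[of "1 - \<alpha> - \<gamma>\<^sub>2"] by simp
      show "(\<lambda>n. real n * \<epsilon> n * measure (P n) {\<omega> \<in> space (P n). real n < Y n 1 \<omega>}) \<longlonglongrightarrow> 0"
      proof (rule tendsto_sandwich[OF always_eventually _ tendsto_const])
        show "\<forall>n. 0 \<le> real n * \<epsilon> n * measure (P n) {\<omega> \<in> space (P n). real n < Y n 1 \<omega>}"
          by (simp add: \<epsilon>)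
        show "\<forall>\<^sub>F n in sequentially. real n * \<epsilon> n * measure (P n) {\<omega> \<in> space (P n). real n < Y n 1 \<omega>}
            \<le> C * real n powr (1 - \<alpha> - \<gamma>\<^sub>2)"
          using rows
        proof eventually_elim
          case (elim n)
          then interpret R: contaminated_row "P n" F\<^sub>1 F\<^sub>2 "M n" "\<epsilon> n" n "X n" "Y n" "B n" D by simp
          have "measure (P n) {\<omega> \<in> space (P n). real n < Y n 1 \<omega>} \<le> C * real n powr (- \<alpha>)"
            using R.Y_tail[of 1 "real n"] C(2)[of "real n"] R.n by simp
          then have "real n * \<epsilon> n * measure (P n) {\<omega> \<in> space (P n). real n < Y n 1 \<omega>}
              \<le> real n * \<epsilon> n * (C * real n powr (- \<alpha>))"
            using R.\<epsilon> by (intro mult_left_mono) auto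
          also have "\<dots> = C * (real n powr 1 * real n powr (- \<gamma>\<^sub>2) * real n powr (- \<alpha>))"
            using R.n by (simp add: \<epsilon>)
          also have "\<dots> = C * real n powr (1 - \<alpha> - \<gamma>\<^sub>2)"
            unfolding powr_add[symmetric] by (simp add: algebra_simps)
          finally show ?case .
        qed
        show "(\<lambda>n. C * real n powr (1 - \<alpha> - \<gamma>\<^sub>2)) \<longlonglongrightarrow> 0"
          using g by (intro tendsto_mult_right_zero nat_powr) simp
      qed
    qed simp
    show "(\<lambda>n. prob_space.expectation (P n) (X n 1)) \<longlonglongrightarrow> m"
      by (rule tendsto_eventually) (use facts in \<open>auto elim!: eventually_mono\<close>)
  qed (use m in simp)

  show ?thesis
    using case_small case_large case_middle by auto
qed

end
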